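(* Let $n\ge1$, $m>0$, and let $u$ be a positive and bounded solution of $\frac{\partial u}{\partial t}=\Delta u^m$ on $(0,\infty)\times\mathbb{R}^n$ with initial value $u_0=u(0,\cdot)$. Let $T>0$ and $x\in\mathbb{R}^n$. Let $h\in\mathbb{R}$ satisfy $$(h-h_-)(h-h_+)>0,\qquad h_\pm=m\pm\sqrt{1-(n-1)(m-1)^2},$$ and set $$U_\pm=\frac{mh\pm|h|\sqrt{m^2+(h-h_-)(h-h_+)}}{(h-h_-)(h-h_+)},\qquad u_{\min}^{h,T}=\inf_{(t,y)\in[0,T]\times\mathbb{R}^n}u^h(t,y),\qquad U=\frac{\left\|u_0^h\right\|_\infty}{u_{\min}^{h,T}}-1.$$ If $U\in(U_-,U_+)$, then $$u^{m+h-3}|\nabla u|^2(T,x)\le 2\,\frac{\left\|u_0^h\right\|_\infty-u^h(T,x)}{mT\,(h-h_-)(h-h_+)\,U^{-1}(U-U_-)(U_+-U)}.$$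
   Context: The numbers $h_\pm$ may be complex conjugates; in all cases $(h-h_-)(h-h_+)$ denotes the real number $h^2-2mh+n(m-1)^2+2(m-1)$. $\|\cdot\|_\infty$ is the essential supremum norm on $\mathbb{R}^n$; $\Delta$ and $\nabla$ act on the space variables. The hypothesis $U\in(U_-,U_+)$ includes that $U$ is finite (so $\|u_0^h\|_\infty<\infty$ and $u_{\min}^{h,T}>0$). If $U=0$ the right-hand side is read as $0$. Standing assumption: $u$ is positive, bounded and smooth on $[0,\infty)\times\mathbb{R}^n$. *)

theory Defs
  imports "HOL-Probability.Essential_Supremum"
begin

section \<open>Smooth functions, gradient and Laplacian\<close>

text \<open>
  The derivatives are taken within \<open>S\<close>.  On a closed half-space they are unique, so
  \<open>Ck_on k S f\<close> says that all derivatives of order at most \<open>k\<close> exist and are continuous up to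
  the boundary, those across the boundary being one-sided.
\<close>

primrec Ck_on :: "nat \<Rightarrow> 'a::euclidean_space set \<Rightarrow> ('a \<Rightarrow> real) \<Rightarrow> bool" where
  "Ck_on 0 S f \<longleftrightarrow> continuous_on S f"
| "Ck_on (Suc k) S f \<longleftrightarrow>
     (\<exists>f'. (\<forall>z\<in>S. (f has_derivative f' z) (at z within S)) \<and> (\<forall>v. Ck_on k S (\<lambda>z. f' z v)))"

definition smooth_on :: "'a::euclidean_space set \<Rightarrow> ('a \<Rightarrow> real) \<Rightarrow> bool" where
  "smooth_on S f \<longleftrightarrow> (\<forall>k. Ck_on k S f)"

definition partial_deriv :: "'n::finite \<Rightarrow> (real^'n \<Rightarrow> real) \<Rightarrow> real^'n \<Rightarrow> real" where
  "partial_deriv i f x = deriv (\<lambda>s. f (x + s *\<^sub>R axis i 1)) 0"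

definition gradient :: "(real^'n \<Rightarrow> real) \<Rightarrow> real^'n \<Rightarrow> real^'n" where
  "gradient f x = (\<chi> i. partial_deriv i f x)"

definition laplacian :: "(real^'n \<Rightarrow> real) \<Rightarrow> real^'n \<Rightarrow> real" where
  "laplacian f x = (\<Sum>i\<in>UNIV. partial_deriv i (partial_deriv i f) x)"

lemma gradient_eq_GDERIV:
  assumes "GDERIV f x :> D"
  shows "gradient f x = D"
proof -
  have "partial_deriv i f x = D $ i" for i
  proof -
    have f: "(f has_derivative (\<lambda>h. h \<bullet> D)) (at (x + 0 *\<^sub>R axis i 1))"
      using assms by (simp add: gderiv_def)
    have "((\<lambda>s::real. x + s *\<^sub>R axis i 1) has_derivative (\<lambda>s. s *\<^sub>R axis i 1)) (at 0)"
      by (auto intro!: derivative_eq_intros)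
    from has_derivative_compose[OF this f]
    have "((\<lambda>s. f (x + s *\<^sub>R axis i 1)) has_real_derivative D $ i) (at 0)"
      by (simp add: has_field_derivative_def inner_axis' mult_commute_abs)
    then show ?thesis
      unfolding partial_deriv_def by (rule DERIV_imp_deriv)
  qed
  then show ?thesis
    by (simp add: gradient_def vec_eq_iff)
qed


section \<open>The constants\<close>

definition h_minus :: "nat \<Rightarrow> real \<Rightarrow> complex" where
  "h_minus n m = of_real m - csqrt (of_real (1 - (real n - 1) * (m - 1)\<^sup>2))"

definition h_plus :: "nat \<Rightarrow> real \<Rightarrow> complex" where
  "h_plus n m = of_real m + csqrt (of_real (1 - (real n - 1) * (m - 1)\<^sup>2))"

text \<open>The real number \<open>(h - h\<^sub>-) (h - h\<^sub>+)\<close>, also when \<open>h\<^sub>\<plusminus>\<close> are not real.\<close>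

definition h_prod :: "nat \<Rightarrow> real \<Rightarrow> real \<Rightarrow> real" where
  "h_prod n m h = h\<^sup>2 - 2 * m * h + real n * (m - 1)\<^sup>2 + 2 * (m - 1)"

lemma of_real_h_prod:
  "complex_of_real (h_prod n m h) = (of_real h - h_minus n m) * (of_real h - h_plus n m)"
proof -
  define r where "r = 1 - (real n - 1) * (m - 1)\<^sup>2"
  have "(of_real h - h_minus n m) * (of_real h - h_plus n m)
      = (complex_of_real h - of_real m)\<^sup>2 - (csqrt (of_real r))\<^sup>2"
    unfolding h_minus_def h_plus_def r_def by (simp add: power2_eq_square algebra_simps del: power2_csqrt)
  also have "\<dots> = of_real ((h - m)\<^sup>2 - r)"
    by simp
  also have "(h - m)\<^sup>2 - r = h_prod n m h"
    by (simp add: r_def h_prod_def power2_eq_square algebra_simps)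
  finally show ?thesis ..
qed

definition U_minus :: "nat \<Rightarrow> real \<Rightarrow> real \<Rightarrow> real" where
  "U_minus n m h = (m * h - \<bar>h\<bar> * sqrt (m\<^sup>2 + h_prod n m h)) / h_prod n m h"

definition U_plus :: "nat \<Rightarrow> real \<Rightarrow> real \<Rightarrow> real" where
  "U_plus n m h = (m * h + \<bar>h\<bar> * sqrt (m\<^sup>2 + h_prod n m h)) / h_prod n m h"


section \<open>The norm of the initial value and the oscillation\<close>

definition norm_inf :: "(real^'n \<Rightarrow> real) \<Rightarrow> ereal" where
  "norm_inf f = esssup lborel (\<lambda>y. ereal \<bar>f y\<bar>)"

definition u_min :: "(real \<Rightarrow> real^'n \<Rightarrow> real) \<Rightarrow> real \<Rightarrow> real \<Rightarrow> ereal" where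
  "u_min u h T = (INF (t, y) \<in> {0..T} \<times> UNIV. ereal (u t y powr h))"

text \<open>
  For positive \<open>u\<close> the value is \<open>\<infinity>\<close> if the norm is infinite or the infimum is \<open>0\<close>
  (\<open>a / 0 = \<infinity>\<close> for positive \<open>a :: ereal\<close>), so a real upper bound excludes both.
\<close>

definition U_ratio :: "(real \<Rightarrow> real^'n \<Rightarrow> real) \<Rightarrow> real \<Rightarrow> real \<Rightarrow> ereal" where
  "U_ratio u h T = norm_inf (\<lambda>y. u 0 y powr h) / u_min u h T - 1"

end

(* Write X = u^(m+h-3) |grad u|^2 / (N - u^h) as |grad w|^2 for a primitive w = W(u).  Then w solves
   w_t = a(w) Lap w + b(w) |grad w|^2, and Bernstein's method applied to P = |grad w|^2 gives, at a
   spatial critical point of P, P_t <= a Lap P - kappa P^2.  There the Hessian of w annihilates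
   grad w, so that (Lap w)^2 <= (n-1) |Hess w|^2; with this sharper trace inequality kappa
   is (m/2) (- D rho + 2 m h + h^2 / rho), where rho = N / u^h - 1.  This is decreasing in rho, hence at
   least its value at the largest rho, namely U, and it factors through U - U_- and U_+ - U.  Comparing
   with the solution 1 / (kappa t) of the ODE p' = - kappa p^2 yields the estimate.

   No derivative bounds at spatial infinity are available, so P is multiplied by a cutoff whose error
   terms the term - kappa P^2 absorbs; and N is replaced by N + eta to keep N - u^h away from 0.
   That u^h <= N persists for t > 0 is a comparison principle.  For m < 1 the diffusivity
   blows up as u -> 0; there the power u^(m/(n+1)) has a gradient term with the right sign. *)

theory Submission
  imports Defs
begin

section \<open>Smooth functions and directional derivatives\<close>

text \<open>The sharp constant dictates the trace inequality. The Hessian H enters as 2 A' P tr H -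
  2 A |H|^2, and maximising this under (tr H)^2 <= k |H|^2 contributes k A'^2 P^2 / (2 A). Only k =
  n - 1 makes the resulting quadratic reproduce (h - h_-)(h - h_+); the usual k = n would replace
  that number by itself plus (m - 1)^2.

  The exponent m + h - 3 is the one for which the coefficient of P^2 depends on u through rho alone,
  so that a monotonicity in one variable suffices.

  The hypothesis bounds u^h from below on [0,T], which is a bound on u from one side only: from
  below if h > 0, from above if h < 0. The other side must be propagated from the initial value on
  an unbounded domain. For h > 0 this is an upper bound, reached with the diffusivity already under
  control. For h < 0 it is a lower bound, where no positive lower bound at later times is known
  beforehand; this is the harder case.\<close>

lemma Ck_on_cong:
  assumes "Ck_on k S f" "\<And>z. z \<in> S \<Longrightarrow> f z = g z"
  shows "Ck_on k S g"
proof (cases k)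
  case 0
  then show ?thesis using assms by (simp cong: continuous_on_cong)
next
  case (Suc j)
  then obtain f' where f': "\<forall>z\<in>S. (f has_derivative f' z) (at z within S)"
      "\<forall>v. Ck_on j S (\<lambda>z. f' z v)"
    using assms(1) by auto
  have "\<forall>z\<in>S. (g has_derivative f' z) (at z within S)"
    using f'(1) assms(2) by (metis has_derivative_transform)
  then show ?thesis using f'(2) Suc by auto
qed

lemma Ck_on_subset:
  "Ck_on k S f \<Longrightarrow> S' \<subseteq> S \<Longrightarrow> Ck_on k S' f"
proof (induction k arbitrary: f)
  case 0
  then show ?case by (auto intro: continuous_on_subset)
next
  case (Suc k)
  then show ?case by (simp, meson has_derivative_subset subsetD)
qed

text \<open>The successor clause of \<open>Ck_on\<close> speaks only about derivatives. At the
  bottom of the induction continuity is recovered from differentiability.\<close>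

lemma Ck_on_SucD: "Ck_on (Suc k) S f \<Longrightarrow> Ck_on k S f"
proof (induction k arbitrary: f)
  case 0
  then show ?case
    by (auto simp: continuous_on_eq_continuous_within intro: has_derivative_continuous)
next
  case (Suc k)
  then show ?case by (metis Ck_on.simps(2))
qed

lemma Ck_on_const: "Ck_on k S (\<lambda>_. c)"
  by (induction k arbitrary: c)
    (auto intro!: exI[of _ "\<lambda>_ _. 0"] continuous_intros derivative_eq_intros)

lemma Ck_on_add: "Ck_on k S f \<Longrightarrow> Ck_on k S g \<Longrightarrow> Ck_on k S (\<lambda>z. f z + g z)"
proof (induction k arbitrary: f g)
  case 0
  then show ?case by (auto intro: continuous_intros)
next
  case (Suc k)
  then obtain f' g' where
    "\<forall>z\<in>S. (f has_derivative f' z) (at z within S)" "\<forall>v. Ck_on k S (\<lambda>z. f' z v)"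
    "\<forall>z\<in>S. (g has_derivative g' z) (at z within S)" "\<forall>v. Ck_on k S (\<lambda>z. g' z v)"
    by auto
  then show ?case
    by (auto intro!: exI[of _ "\<lambda>z v. f' z v + g' z v"] has_derivative_add Suc.IH)
qed

lemma Ck_on_mult: "Ck_on k S f \<Longrightarrow> Ck_on k S g \<Longrightarrow> Ck_on k S (\<lambda>z. f z * g z)"
proof (induction k arbitrary: f g)
  case 0
  then show ?case by (auto intro: continuous_intros)
next
  case (Suc k)
  then obtain f' g' where
    "\<forall>z\<in>S. (f has_derivative f' z) (at z within S)" "\<forall>v. Ck_on k S (\<lambda>z. f' z v)"
    "\<forall>z\<in>S. (g has_derivative g' z) (at z within S)" "\<forall>v. Ck_on k S (\<lambda>z. g' z v)"
    by auto
  moreover have "Ck_on k S f" "Ck_on k S g"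
    using Suc.prems Ck_on_SucD by blast+
  ultimately show ?case
    by (auto intro!: exI[of _ "\<lambda>z v. f z * g' z v + f' z v * g z"] has_derivative_mult
        Ck_on_add Suc.IH)
qed

lemma Ck_on_sum: "(\<And>i. i \<in> I \<Longrightarrow> Ck_on k S (f i)) \<Longrightarrow> Ck_on k S (\<lambda>z. \<Sum>i\<in>I. f i z)"
  by (induction I rule: infinite_finite_induct) (auto intro: Ck_on_const Ck_on_add)

lemma Ck_on_compose:
  fixes F :: "real \<Rightarrow> real"
  assumes "Ck_on k J F" "Ck_on k S f" "f ` S \<subseteq> J"
  shows "Ck_on k S (\<lambda>z. F (f z))"
  using assms
proof (induction k arbitrary: F)
  case 0
  then show ?case by (auto intro: continuous_on_compose2)
next
  case (Suc k)
  then obtain f' F' where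
    f': "\<forall>z\<in>S. (f has_derivative f' z) (at z within S)" "\<forall>v. Ck_on k S (\<lambda>z. f' z v)" and
    F': "\<forall>r\<in>J. (F has_derivative F' r) (at r within J)" "\<forall>v. Ck_on k J (\<lambda>r. F' r v)"
    by auto
  have "((\<lambda>z. F (f z)) has_derivative (\<lambda>v. F' (f z) 1 * f' z v)) (at z within S)" if "z \<in> S" for z
  proof -
    have "((\<lambda>z. F (f z)) has_derivative (\<lambda>v. F' (f z) (f' z v))) (at z within S)"
      by (rule has_derivative_in_compose2[where t = J and g' = F'])
        (use f'(1) F'(1) Suc.prems(3) that in blast)+
    \<comment> \<open>The induction hypothesis treats \<open>F'\<close> in a fixed direction,
      whereas here the direction \<open>f' z v\<close> varies with \<open>z\<close>. Linearity on
      the real line moves it out as a factor.\<close>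
    moreover have "(\<lambda>v. F' (f z) (f' z v)) = (\<lambda>v. F' (f z) 1 * f' z v)"
    proof
      fix v
      have "f z \<in> J" using Suc.prems(3) that by auto
      then interpret bounded_linear "F' (f z)"
        using F'(1) has_derivative_bounded_linear by blast
      show "F' (f z) (f' z v) = F' (f z) 1 * f' z v"
        using scaleR[of "f' z v" 1] by simp
    qed
    ultimately show ?thesis by simp
  qed
  moreover have "Ck_on k S (\<lambda>z. F' (f z) 1)"
    using F'(2) Suc.IH Suc.prems Ck_on_SucD by blast
  ultimately show ?case
    using f'(2) by (auto intro!: exI[of _ "\<lambda>z v. F' (f z) 1 * f' z v"] Ck_on_mult)
qed

lemma Ck_on_powr: "Ck_on k {0<..} (\<lambda>r::real. r powr a)"
proof (induction k arbitrary: a)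
  case 0
  then show ?case by (auto intro!: continuous_intros)
next
  case (Suc k)
  have "((\<lambda>r::real. r powr a) has_derivative (\<lambda>v. a * r powr (a - 1) * v)) (at r within {0<..})"
    if "r > 0" for r
    using that has_real_derivative_powr[of r a]
    by (auto simp: has_field_derivative_def intro: has_derivative_at_withinI)
  then show ?case
    by (auto intro!: exI[of _ "\<lambda>r v. a * r powr (a - 1) * v"] Ck_on_mult Ck_on_const Suc)
qed

lemma smooth_on_subset: "smooth_on S f \<Longrightarrow> S' \<subseteq> S \<Longrightarrow> smooth_on S' f"
  using Ck_on_subset unfolding smooth_on_def by blast

lemma smooth_on_const: "smooth_on S (\<lambda>_. c)"
  by (simp add: smooth_on_def Ck_on_const)

lemma smooth_on_add: "smooth_on S f \<Longrightarrow> smooth_on S g \<Longrightarrow> smooth_on S (\<lambda>z. f z + g z)"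
  by (simp add: smooth_on_def Ck_on_add)

lemma smooth_on_mult: "smooth_on S f \<Longrightarrow> smooth_on S g \<Longrightarrow> smooth_on S (\<lambda>z. f z * g z)"
  by (simp add: smooth_on_def Ck_on_mult)

lemma smooth_on_sum: "(\<And>i. i \<in> I \<Longrightarrow> smooth_on S (f i)) \<Longrightarrow> smooth_on S (\<lambda>z. \<Sum>i\<in>I. f i z)"
  by (simp add: smooth_on_def Ck_on_sum)

lemma smooth_on_compose:
  fixes F :: "real \<Rightarrow> real"
  shows "smooth_on J F \<Longrightarrow> smooth_on S f \<Longrightarrow> f ` S \<subseteq> J \<Longrightarrow> smooth_on S (\<lambda>z. F (f z))"
  using Ck_on_compose unfolding smooth_on_def by blast

lemma smooth_on_powr:
  assumes "smooth_on S f" "\<And>z. z \<in> S \<Longrightarrow> f z > 0"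
  shows "smooth_on S (\<lambda>z. f z powr a)"
  by (rule smooth_on_compose[where J = "{0<..}"])
    (use assms Ck_on_powr in \<open>auto simp: smooth_on_def\<close>)

lemma smooth_on_continuous_on: "smooth_on S f \<Longrightarrow> continuous_on S f"
  using Ck_on.simps(1) unfolding smooth_on_def by blast

text \<open>The change of variable \<open>W\<close> used later is known only through its derivative;
  its smoothness is that of the explicit integrand, one order higher.\<close>

lemma smooth_on_antiderivative:
  fixes W G :: "real \<Rightarrow> real"
  assumes "smooth_on J G"
    and "\<And>r. r \<in> J \<Longrightarrow> (W has_real_derivative G r) (at r within J)"
  shows "smooth_on J W"
  unfolding smooth_on_def
proof
  fix k
  have "Ck_on (Suc k) J W"
    using assms
    by (auto simp: smooth_on_def has_field_derivative_def intro!: exI[of _ "\<lambda>r v. G r * v"]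
        Ck_on_mult Ck_on_const)
  then show "Ck_on k J W" by (rule Ck_on_SucD)
qed

section \<open>Directional derivatives and the symmetry of second derivatives\<close>

definition dd :: "'a::euclidean_space \<Rightarrow> ('a \<Rightarrow> real) \<Rightarrow> 'a \<Rightarrow> real" where
  "dd v f z = frechet_derivative f (at z) v"

lemma dd_eqI: "(f has_derivative f') (at z) \<Longrightarrow> dd v f z = f' v"
  unfolding dd_def by (metis frechet_derivative_at)

text \<open>Functions that agree near \<open>z\<close> have the same set of derivatives there, so
  the choice made by \<open>frechet_derivative\<close> agrees as well, differentiable or
  not.\<close>

lemma dd_cong:
  assumes "open S" "z \<in> S" "\<And>y. y \<in> S \<Longrightarrow> f y = g y"
  shows "dd v f z = dd v g z"
proof -
  have "(f has_derivative D) (at z) \<longleftrightarrow> (g has_derivative D) (at z)" for D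
    using assms has_derivative_transform_within_open[of _ D z UNIV S] by fastforce
  then show ?thesis by (simp add: dd_def frechet_derivative_def)
qed

lemma smooth_on_has_derivative:
  assumes "smooth_on S f" "open S" "z \<in> S"
  shows "(f has_derivative (\<lambda>v. dd v f z)) (at z)"
proof -
  have "Ck_on (Suc 0) S f" using assms(1) unfolding smooth_on_def by blast
  then obtain D where "\<forall>z\<in>S. (f has_derivative D z) (at z within S)"
    by auto
  then have "(f has_derivative D z) (at z)"
    using assms(2,3) at_within_open by metis
  then show ?thesis using dd_eqI by fastforce
qed

lemma smooth_on_dd:
  assumes "smooth_on S f" "open S"
  shows "smooth_on S (dd v f)"
  unfolding smooth_on_def
proof
  fix k
  have "Ck_on (Suc k) S f" using assms(1) unfolding smooth_on_def by blast
  then obtain f' where f': "\<forall>z\<in>S. (f has_derivative f' z) (at z within S)"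
      "Ck_on k S (\<lambda>z. f' z v)"
    by auto
  have "f' z v = dd v f z" if "z \<in> S" for z
    using f'(1) that assms(2) at_within_open dd_eqI by metis
  with f'(2) show "Ck_on k S (dd v f)"
    by (rule Ck_on_cong)
qed

lemma dd_line:
  assumes "smooth_on S f" "open S" "z + s *\<^sub>R v \<in> S"
  shows "((\<lambda>s. f (z + s *\<^sub>R v)) has_real_derivative dd v f (z + s *\<^sub>R v)) (at s)"
proof -
  have "((\<lambda>s. z + s *\<^sub>R v) has_derivative (\<lambda>s. s *\<^sub>R v)) (at s)"
    by (auto intro!: derivative_eq_intros)
  from has_derivative_compose[OF this smooth_on_has_derivative[OF assms]]
  have "((\<lambda>s. f (z + s *\<^sub>R v)) has_derivative (\<lambda>r. dd (r *\<^sub>R v) f (z + s *\<^sub>R v))) (at s)" .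
  moreover have "dd (r *\<^sub>R v) f (z + s *\<^sub>R v) = dd v f (z + s *\<^sub>R v) * r" for r
    using linear_cmul[OF has_derivative_linear[OF smooth_on_has_derivative[OF assms]]]
    by simp
  ultimately show ?thesis by (simp add: has_field_derivative_def)
qed

lemma dd_add:
  assumes "smooth_on S f" "smooth_on S g" "open S" "z \<in> S"
  shows "dd v (\<lambda>z. f z + g z) z = dd v f z + dd v g z"
  by (intro dd_eqI has_derivative_add smooth_on_has_derivative) (use assms in auto)

lemma dd_mult:
  assumes "smooth_on S f" "smooth_on S g" "open S" "z \<in> S"
  shows "dd v (\<lambda>z. f z * g z) z = f z * dd v g z + dd v f z * g z"
  by (rule dd_eqI[OF has_derivative_mult[OF smooth_on_has_derivative smooth_on_has_derivative]])
    (use assms in auto)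

lemma dd_sum:
  assumes "\<And>i. i \<in> I \<Longrightarrow> smooth_on S (f i)" "open S" "z \<in> S"
  shows "dd v (\<lambda>z. \<Sum>i\<in>I. f i z) z = (\<Sum>i\<in>I. dd v (f i) z)"
  by (rule dd_eqI[OF has_derivative_sum[OF smooth_on_has_derivative]])
    (use assms in auto)

lemma dd_compose:
  fixes F :: "real \<Rightarrow> real"
  assumes "smooth_on S f" "open S" "z \<in> S" "f ` S \<subseteq> J"
    and "(F has_real_derivative d) (at (f z) within J)"
  shows "dd v (\<lambda>z. F (f z)) z = d * dd v f z"
proof -
  have "((\<lambda>z. F (f z)) has_derivative (\<lambda>v. d * dd v f z)) (at z within S)"
  proof (rule has_derivative_in_compose[where f = f and g' = "(*) d"])
    show "(f has_derivative (\<lambda>v. dd v f z)) (at z within S)"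
      by (rule has_derivative_at_withinI, rule smooth_on_has_derivative) (fact assms)+
    show "(F has_derivative (*) d) (at (f z) within f ` S)"
      using assms(4,5) has_derivative_subset unfolding has_field_derivative_def by blast
  qed
  then have "((\<lambda>z. F (f z)) has_derivative (\<lambda>v. d * dd v f z)) (at z)"
    using assms(2,3) at_within_open by metis
  then show ?thesis by (rule dd_eqI)
qed

text \<open>The second difference over the parallelogram with sides s v and s w is symmetric in v
  and w. Two mean value theorems, applied in either order, express it as s^2 times a mixed
  derivative at a nearby point. Letting s tend to 0, continuity of both mixed derivatives gives
  equality at \<open>z\<close>.\<close>

lemma dd_commute:
  assumes "smooth_on S f" "open S" "z \<in> S"
  shows "dd v (dd w f) z = dd w (dd v f) z"
proof -
  have mixed: "\<exists>p. dist p z \<le> s * (norm v + norm w) \<and>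
      f (z + s *\<^sub>R v + s *\<^sub>R w) - f (z + s *\<^sub>R v) - f (z + s *\<^sub>R w) + f z = s\<^sup>2 * dd w (dd v f) p"
    if s: "s > 0" and sub: "cball z (s * (norm v + norm w)) \<subseteq> S" for s v w
  proof -
    have mem: "dist (z + a *\<^sub>R v + b *\<^sub>R w) z \<le> s * (norm v + norm w)"
      if "0 \<le> a" "a \<le> s" "0 \<le> b" "b \<le> s" for a b
    proof -
      have "norm (a *\<^sub>R v + b *\<^sub>R w) \<le> a * norm v + b * norm w"
        using norm_triangle_ineq[of "a *\<^sub>R v" "b *\<^sub>R w"] that by simp
      also have "\<dots> \<le> s * norm v + s * norm w"
        using that by (intro add_mono mult_right_mono) auto
      finally show ?thesis by (simp add: dist_norm algebra_simps)
    qed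
    have inS: "z + a *\<^sub>R v + b *\<^sub>R w \<in> S" if "0 \<le> a" "a \<le> s" "0 \<le> b" "b \<le> s" for a b
      using mem[OF that] sub by (auto simp: dist_commute)
    \<comment> \<open>The second difference is the increment of this first difference along
      v.\<close>
    define \<phi> where "\<phi> r = f (z + r *\<^sub>R v + s *\<^sub>R w) - f (z + r *\<^sub>R v)" for r
    have "(\<phi> has_real_derivative
        dd v f (z + r *\<^sub>R v + s *\<^sub>R w) - dd v f (z + r *\<^sub>R v)) (at r)" if "0 \<le> r" "r \<le> s" for r
    proof -
      have "((\<lambda>r. f ((z + s *\<^sub>R w) + r *\<^sub>R v)) has_real_derivative
          dd v f ((z + s *\<^sub>R w) + r *\<^sub>R v)) (at r)"
        using inS[OF that, of s] s
        by (intro dd_line[OF assms(1,2)]) (simp add: add.commute add.left_commute)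
      moreover have "((\<lambda>r. f (z + r *\<^sub>R v)) has_real_derivative dd v f (z + r *\<^sub>R v)) (at r)"
        using inS[OF that, of 0] s by (intro dd_line[OF assms(1,2)]) simp
      ultimately show ?thesis
        unfolding \<phi>_def by (auto intro: derivative_eq_intros simp: add_ac)
    qed
    from MVT2[OF s this] obtain \<xi> where \<xi>: "0 < \<xi>" "\<xi> < s" and
      eq1: "\<phi> s - \<phi> 0 = s * (dd v f (z + \<xi> *\<^sub>R v + s *\<^sub>R w) - dd v f (z + \<xi> *\<^sub>R v))"
      by auto
    have "((\<lambda>r. dd v f (z + \<xi> *\<^sub>R v + r *\<^sub>R w)) has_real_derivative
        dd w (dd v f) (z + \<xi> *\<^sub>R v + r *\<^sub>R w)) (at r)" if "0 \<le> r" "r \<le> s" for r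
      using inS[of \<xi> r] that \<xi> by (intro dd_line[OF smooth_on_dd[OF assms(1,2)] assms(2)]) simp
    from MVT2[OF s this] obtain \<eta> where \<eta>: "0 < \<eta>" "\<eta> < s" and
      eq2: "dd v f (z + \<xi> *\<^sub>R v + s *\<^sub>R w) - dd v f (z + \<xi> *\<^sub>R v) =
        s * dd w (dd v f) (z + \<xi> *\<^sub>R v + \<eta> *\<^sub>R w)"
      by auto
    have "f (z + s *\<^sub>R v + s *\<^sub>R w) - f (z + s *\<^sub>R v) - f (z + s *\<^sub>R w) + f z = \<phi> s - \<phi> 0"
      by (simp add: \<phi>_def)
    then show ?thesis
      using eq1 eq2 mem[of \<xi> \<eta>] \<xi> \<eta>
      by (intro exI[of _ "z + \<xi> *\<^sub>R v + \<eta> *\<^sub>R w"]) (auto simp: power2_eq_square)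
  qed
  obtain r where r: "r > 0" "cball z r \<subseteq> S"
    using assms(2,3) open_contains_cball by blast
  define L where "L = norm v + norm w"
  have L: "L \<ge> 0" by (simp add: L_def)
  \<comment> \<open>The scale is such that the balls of radius \<open>s k * L\<close> stay in
    \<open>cball z r\<close>; dividing by L + 1 covers the case that both directions vanish.\<close>
  define s where "s k = r / (L + 1) * inverse (real (Suc k))" for k
  have s0: "s k > 0" for k using r L by (simp add: s_def)
  have "s k * L \<le> r" for k
  proof -
    have "inverse (real (Suc k)) \<le> 1" by (simp add: inverse_le_1_iff)
    then have "s k \<le> r / (L + 1) * 1"
      unfolding s_def using r L by (intro mult_left_mono) auto
    then have "s k * L \<le> r / (L + 1) * L"
      using L by (intro mult_right_mono) auto
    also have "\<dots> \<le> r" using r L by (simp add: field_simps)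
    finally show ?thesis .
  qed
  then have sub: "cball z (s k * (norm v + norm w)) \<subseteq> S" for k
    using r(2) unfolding L_def by (meson dual_order.trans subset_cball)
  have "\<exists>p q. dist p z \<le> s k * L \<and> dist q z \<le> s k * L \<and> dd w (dd v f) p = dd v (dd w f) q" for k
  proof -
    obtain p where p: "dist p z \<le> s k * L" "f (z + s k *\<^sub>R v + s k *\<^sub>R w) - f (z + s k *\<^sub>R v)
        - f (z + s k *\<^sub>R w) + f z = (s k)\<^sup>2 * dd w (dd v f) p"
      using mixed[OF s0 sub] unfolding L_def by metis
    obtain q where q: "dist q z \<le> s k * L" "f (z + s k *\<^sub>R w + s k *\<^sub>R v) - f (z + s k *\<^sub>R w)
        - f (z + s k *\<^sub>R v) + f z = (s k)\<^sup>2 * dd v (dd w f) q"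
      using mixed[OF s0, of k w v] sub[of k] unfolding L_def by (metis add.commute)
    have "(s k)\<^sup>2 * dd w (dd v f) p = (s k)\<^sup>2 * dd v (dd w f) q"
      using p(2) q(2) arg_cong[OF add.commute[of "s k *\<^sub>R v" "s k *\<^sub>R w"], of "\<lambda>y. f (z + y)"]
      unfolding add.assoc by linarith
    then show ?thesis using p(1) q(1) s0[of k] by auto
  qed
  then obtain p q where pq: "\<And>k. dist (p k) z \<le> s k * L" "\<And>k. dist (q k) z \<le> s k * L"
      "\<And>k. dd w (dd v f) (p k) = dd v (dd w f) (q k)"
    by metis
  have "(\<lambda>k. s k * L) \<longlonglongrightarrow> (r / (L + 1) * 0) * L"
    unfolding s_def by (intro tendsto_intros LIMSEQ_inverse_real_of_nat)
  then have lim0: "(\<lambda>k. s k * L) \<longlonglongrightarrow> 0" by simp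
  have lim: "p \<longlonglongrightarrow> z" "q \<longlonglongrightarrow> z"
    unfolding tendsto_dist_iff[of _ z]
    by (rule tendsto_sandwich[OF _ _ tendsto_const lim0]; simp add: pq)+
  have "isCont (dd w (dd v f)) z" "isCont (dd v (dd w f)) z"
    using assms smooth_on_continuous_on smooth_on_dd continuous_on_eq_continuous_at by metis+
  then have "(\<lambda>k. dd w (dd v f) (p k)) \<longlonglongrightarrow> dd w (dd v f) z"
    "(\<lambda>k. dd v (dd w f) (q k)) \<longlonglongrightarrow> dd v (dd w f) z"
    using lim isCont_tendsto_compose by blast+
  then show ?thesis using pq(3) LIMSEQ_unique by fastforce
qed

section \<open>Bernstein identity\<close>

abbreviation dt :: "(real \<times> (real^'n) \<Rightarrow> real) \<Rightarrow> real \<times> (real^'n) \<Rightarrow> real" where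
  "dt \<equiv> dd (1, 0)"

abbreviation dx :: "'n::finite \<Rightarrow> (real \<times> (real^'n) \<Rightarrow> real) \<Rightarrow> real \<times> (real^'n) \<Rightarrow> real" where
  "dx i \<equiv> dd (0, axis i 1)"

definition lap :: "(real \<times> (real^'n) \<Rightarrow> real) \<Rightarrow> real \<times> (real^'n) \<Rightarrow> real" where
  "lap w z = (\<Sum>i\<in>UNIV. dx i (dx i w) z)"

definition gradsq :: "(real \<times> (real^'n) \<Rightarrow> real) \<Rightarrow> real \<times> (real^'n) \<Rightarrow> real" where
  "gradsq w z = (\<Sum>k\<in>UNIV. dx k w z * dx k w z)"

lemma gradsq_nonneg: "gradsq w z \<ge> 0"
  by (simp add: gradsq_def sum_nonneg)

lemma smooth_on_lap: "smooth_on S w \<Longrightarrow> open S \<Longrightarrow> smooth_on S (lap w)"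
  unfolding lap_def by (intro smooth_on_sum smooth_on_dd)

lemma smooth_on_gradsq: "smooth_on S w \<Longrightarrow> open S \<Longrightarrow> smooth_on S (gradsq w)"
  unfolding gradsq_def by (intro smooth_on_sum smooth_on_mult smooth_on_dd)

text \<open>In a space direction this is twice the Hessian applied to the gradient, the relation
  that links critical points of |grad w|^2 with the Hessian of w.\<close>

lemma dd_gradsq:
  assumes "smooth_on S w" "open S" "z \<in> S"
  shows "dd v (gradsq w) z = (\<Sum>k\<in>UNIV. 2 * (dx k w z * dd v (dx k w) z))"
proof -
  have "dd v (gradsq w) z = (\<Sum>k\<in>UNIV. dd v (\<lambda>z. dx k w z * dx k w z) z)"
    unfolding gradsq_def[abs_def] using assms by (intro dd_sum smooth_on_mult smooth_on_dd)
  also have "\<dots> = (\<Sum>k\<in>UNIV. 2 * (dx k w z * dd v (dx k w) z))"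
    using dd_mult[OF smooth_on_dd smooth_on_dd, where S = S] assms by (intro sum.cong) auto
  finally show ?thesis .
qed

text \<open>Bochner's formula in flat space: commuting third derivatives produces no curvature
  term.\<close>

lemma lap_gradsq:
  assumes "smooth_on S w" "open S" "z \<in> S"
  shows "lap (gradsq w) z = 2 * (\<Sum>i\<in>UNIV. \<Sum>k\<in>UNIV. (dx i (dx k w) z)\<^sup>2)
    + 2 * (\<Sum>k\<in>UNIV. dx k w z * dx k (lap w) z)"
proof -
  have sm: "smooth_on S (dd v w)" "smooth_on S (dd v (dd v' w))" for v v'
    using assms smooth_on_dd by blast+
  have third: "dx k (lap w) z = (\<Sum>i\<in>UNIV. dx i (dx i (dx k w)) z)" for k
  proof -
    have "dx k (lap w) z = (\<Sum>i\<in>UNIV. dx k (dx i (dx i w)) z)"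
      unfolding lap_def[abs_def] using sm assms by (intro dd_sum)
    also have "\<dots> = (\<Sum>i\<in>UNIV. dx i (dx k (dx i w)) z)"
      using sm assms by (intro sum.cong dd_commute[where S = S]) auto
    also have "\<dots> = (\<Sum>i\<in>UNIV. dx i (dx i (dx k w)) z)"
      using assms by (intro sum.cong dd_cong[where S = S] dd_commute[where S = S]) auto
    finally show ?thesis .
  qed
  have "dx i (dx i (gradsq w)) z
      = (\<Sum>k\<in>UNIV. 2 * (dx i (dx k w) z)\<^sup>2 + 2 * (dx k w z * dx i (dx i (dx k w)) z))" for i
  proof -
    have "dx i (dx i (gradsq w)) z = dx i (\<lambda>z. \<Sum>k\<in>UNIV. 2 * (dx k w z * dx i (dx k w) z)) z"
      using assms by (intro dd_cong[where S = S] dd_gradsq) auto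
    also have "\<dots> = (\<Sum>k\<in>UNIV. dx i (\<lambda>z. 2 * (dx k w z * dx i (dx k w) z)) z)"
      using sm assms by (intro dd_sum smooth_on_mult smooth_on_const)
    also have "\<dots> = (\<Sum>k\<in>UNIV. 2 * (dx i (dx k w) z)\<^sup>2 + 2 * (dx k w z * dx i (dx i (dx k w)) z))"
    proof (rule sum.cong)
      fix k
      have "dx i (\<lambda>z. 2 * (dx k w z * dx i (dx k w) z)) z
          = 2 * dx i (\<lambda>z. dx k w z * dx i (dx k w) z) z + dx i (\<lambda>_. 2) z * (dx k w z * dx i (dx k w) z)"
        using sm assms by (intro dd_mult[where S = S] smooth_on_mult smooth_on_const)
      moreover have "dx i (\<lambda>_. 2) z = 0"
        by (rule dd_eqI[where f' = "\<lambda>_. 0"]) simp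
      moreover have "dx i (\<lambda>z. dx k w z * dx i (dx k w) z) z
          = dx k w z * dx i (dx i (dx k w)) z + dx i (dx k w) z * dx i (dx k w) z"
        using sm assms by (intro dd_mult[where S = S])
      ultimately show "dx i (\<lambda>z. 2 * (dx k w z * dx i (dx k w) z)) z
          = 2 * (dx i (dx k w) z)\<^sup>2 + 2 * (dx k w z * dx i (dx i (dx k w)) z)"
        by (simp add: power2_eq_square)
    qed simp
    finally show ?thesis .
  qed
  then have "lap (gradsq w) z
      = (\<Sum>i\<in>UNIV. \<Sum>k\<in>UNIV. 2 * (dx i (dx k w) z)\<^sup>2 + 2 * (dx k w z * dx i (dx i (dx k w)) z))"
    by (simp add: lap_def)
  also have "\<dots> = 2 * (\<Sum>i\<in>UNIV. \<Sum>k\<in>UNIV. (dx i (dx k w) z)\<^sup>2)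
      + 2 * (\<Sum>i\<in>UNIV. \<Sum>k\<in>UNIV. dx k w z * dx i (dx i (dx k w)) z)"
    by (simp add: sum.distrib sum_distrib_left)
  also have "(\<Sum>i\<in>UNIV. \<Sum>k\<in>UNIV. dx k w z * dx i (dx i (dx k w)) z)
      = (\<Sum>k\<in>UNIV. dx k w z * dx k (lap w) z)"
    unfolding third sum_distrib_left by (rule sum.swap)
  finally show ?thesis .
qed

text \<open>Each space derivative of the equation is multiplied by \<open>dx k w\<close> and summed
  over k; Bochner's formula then removes the gradient of \<open>lap w\<close>. The numbers
  \<open>A'\<close> and \<open>B'\<close> are the derivatives of the coefficients with respect to w
  at the point \<open>z\<close>.\<close>

lemma bernstein_identity:
  assumes w: "smooth_on S w" and A: "smooth_on S A" and B: "smooth_on S B"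
    and S: "open S" "z \<in> S"
    and pde: "\<And>z. z \<in> S \<Longrightarrow> dt w z = A z * lap w z + B z * gradsq w z"
    and A': "\<And>k. dx k A z = A' * dx k w z"
    and B': "\<And>k. dx k B z = B' * dx k w z"
  shows "dt (gradsq w) z
    = A z * (lap (gradsq w) z - 2 * (\<Sum>i\<in>UNIV. \<Sum>k\<in>UNIV. (dx i (dx k w) z)\<^sup>2))
      + 2 * B z * (\<Sum>k\<in>UNIV. dx k w z * dx k (gradsq w) z)
      + 2 * A' * gradsq w z * lap w z + 2 * B' * (gradsq w z)\<^sup>2"
proof -
  note sm = smooth_on_lap[OF w S(1)] smooth_on_gradsq[OF w S(1)]
  have eq: "dt (dx k w) z = A z * dx k (lap w) z + A' * dx k w z * lap w z
      + (B z * dx k (gradsq w) z + B' * dx k w z * gradsq w z)" for k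
  proof -
    have "dt (dx k w) z = dx k (dt w) z"
      by (rule dd_commute[OF w S])
    also have "\<dots> = dx k (\<lambda>z. A z * lap w z + B z * gradsq w z) z"
      using S pde by (rule dd_cong)
    also have "\<dots> = dx k (\<lambda>z. A z * lap w z) z + dx k (\<lambda>z. B z * gradsq w z) z"
      using S sm A B by (intro dd_add[where S = S] smooth_on_mult)
    also have "\<dots> = (A z * dx k (lap w) z + dx k A z * lap w z)
        + (B z * dx k (gradsq w) z + dx k B z * gradsq w z)"
      using S sm A B by (simp add: dd_mult[where S = S])
    finally show ?thesis by (simp add: A' B')
  qed
  have "dt (gradsq w) z = (\<Sum>k\<in>UNIV. 2 * (dx k w z * dt (dx k w) z))"
    using w S by (rule dd_gradsq)
  also have "\<dots> = (\<Sum>k\<in>UNIV. A z * (2 * (dx k w z * dx k (lap w) z))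
      + 2 * B z * (dx k w z * dx k (gradsq w) z)
      + (2 * A' * lap w z + 2 * B' * gradsq w z) * (dx k w z * dx k w z))"
    unfolding eq by (intro sum.cong) (auto simp: algebra_simps)
  also have "\<dots> = A z * (2 * (\<Sum>k\<in>UNIV. dx k w z * dx k (lap w) z))
      + 2 * B z * (\<Sum>k\<in>UNIV. dx k w z * dx k (gradsq w) z)
      + (2 * A' * lap w z + 2 * B' * gradsq w z) * gradsq w z"
    unfolding gradsq_def[of w z] sum.distrib sum_distrib_left by simp
  also have "2 * (\<Sum>k\<in>UNIV. dx k w z * dx k (lap w) z)
      = lap (gradsq w) z - 2 * (\<Sum>i\<in>UNIV. \<Sum>k\<in>UNIV. (dx i (dx k w) z)\<^sup>2)"
    using lap_gradsq[OF w S] by simp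
  finally show ?thesis by (simp add: power2_eq_square algebra_simps)
qed

text \<open>Cauchy-Schwarz against the matrix \<open>P \<delta>\<^sub>i\<^sub>k - p\<^sub>i p\<^sub>k\<close>, a multiple of the projection onto the
  orthogonal complement of \<open>p\<close>, gives the factor \<open>n - 1\<close> instead of \<open>n\<close>.\<close>

lemma trace_orthogonal_bound:
  fixes H :: "'n::finite \<Rightarrow> 'n \<Rightarrow> real" and p :: "'n \<Rightarrow> real"
  defines "P \<equiv> \<Sum>k\<in>UNIV. p k * p k"
  shows "(P * (\<Sum>i\<in>UNIV. H i i) - (\<Sum>i\<in>UNIV. p i * (\<Sum>k\<in>UNIV. H i k * p k)))\<^sup>2
    \<le> (real CARD('n) - 1) * P\<^sup>2 * (\<Sum>i\<in>UNIV. \<Sum>k\<in>UNIV. (H i k)\<^sup>2)"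
proof -
  define M where "M i k = (if i = k then P else 0) - p i * p k" for i k
  have "P * (\<Sum>i\<in>UNIV. H i i) - (\<Sum>i\<in>UNIV. p i * (\<Sum>k\<in>UNIV. H i k * p k))
      = (\<Sum>i\<in>UNIV. \<Sum>k\<in>UNIV. H i k * M i k)"
  proof -
    have "(\<Sum>k\<in>UNIV. H i k * M i k) = P * H i i - p i * (\<Sum>k\<in>UNIV. H i k * p k)" for i
    proof -
      have "(\<Sum>k\<in>UNIV. H i k * M i k)
          = (\<Sum>k\<in>UNIV. (if i = k then P * H i k else 0) - p i * (H i k * p k))"
        by (intro sum.cong) (auto simp: M_def algebra_simps)
      then show ?thesis by (simp add: sum_subtractf sum_distrib_left)
    qed
    then show ?thesis by (simp add: sum_subtractf sum_distrib_left)
  qed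
  also have "\<dots> = (\<Sum>(i, k)\<in>UNIV. H i k * M i k)"
    by (simp add: sum.cartesian_product)
  also have "\<dots>\<^sup>2 \<le> (\<Sum>(i, k)\<in>UNIV. (H i k)\<^sup>2) * (\<Sum>(i, k)\<in>UNIV. (M i k)\<^sup>2)"
    using Cauchy_Schwarz_ineq_sum[of "\<lambda>(i, k). H i k" "\<lambda>(i, k). M i k" UNIV]
    by (simp add: case_prod_unfold)
  also have "(\<Sum>(i, k)\<in>UNIV. (M i k)\<^sup>2) = (\<Sum>i\<in>UNIV. \<Sum>k\<in>UNIV. (M i k)\<^sup>2)"
    by (simp add: sum.cartesian_product)
  \<comment> \<open>M is P times a projection of rank n - 1 when P is positive, so its squared norm
    is P^2 times that rank. The rows give this directly and also cover P = 0.\<close>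
  also have "\<dots> = (real CARD('n) - 1) * P\<^sup>2"
  proof -
    have "(\<Sum>k\<in>UNIV. (M i k)\<^sup>2) = P\<^sup>2 - P * (p i * p i)" for i
    proof -
      have "(\<Sum>k\<in>UNIV. (M i k)\<^sup>2)
          = (\<Sum>k\<in>UNIV. (if i = k then P\<^sup>2 - 2 * P * (p i * p k) else 0) + p i * p i * (p k * p k))"
        by (intro sum.cong) (auto simp: M_def algebra_simps power2_eq_square)
      also have "\<dots> = (P\<^sup>2 - 2 * P * (p i * p i)) + p i * p i * P"
        by (simp add: sum.distrib sum_distrib_left P_def)
      finally show ?thesis by (simp add: algebra_simps)
    qed
    then have "(\<Sum>i\<in>UNIV. \<Sum>k\<in>UNIV. (M i k)\<^sup>2) = real CARD('n) * P\<^sup>2 - P * P"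
      by (simp add: sum_subtractf sum_distrib_left[symmetric] P_def)
    then show ?thesis by (simp add: algebra_simps power2_eq_square)
  qed
  also have "(\<Sum>(i, k)\<in>UNIV. (H i k)\<^sup>2) = (\<Sum>i\<in>UNIV. \<Sum>k\<in>UNIV. (H i k)\<^sup>2)"
    by (simp add: sum.cartesian_product)
  finally show ?thesis by (simp add: mult.commute)
qed

text \<open>The situation at a maximum of \<open>(t - \<tau>) s\<^sup>2 P\<close> with cutoff \<open>s = 1 - \<epsilon>\<^sup>2 |y - x|\<^sup>2\<close>: there
  \<open>\<nabla>P = 2 P \<sigma>\<close> with \<open>\<sigma> = - \<nabla>s / s\<close>, and \<open>L\<close> is the Laplacian of \<open>P\<close>.\<close>

lemma bernstein_absorption:
  fixes H :: "'n::finite \<Rightarrow> 'n \<Rightarrow> real" and p \<sigma> :: "'n \<Rightarrow> real"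
  defines "P \<equiv> \<Sum>k\<in>UNIV. p k * p k"
  assumes P: "P > 0" and s: "0 < s" "s \<le> 1" and e: "0 < \<epsilon>" "\<epsilon> \<le> 1"
    and A: "0 < A" "A \<le> K" and A': "\<bar>A'\<bar> \<le> K" and B: "\<bar>B\<bar> \<le> K"
    and k: "2 * B' + (real CARD('n) - 1) * A'\<^sup>2 / (2 * A) \<le> - \<kappa>"
    and \<sigma>: "(\<Sum>k\<in>UNIV. \<sigma> k * \<sigma> k) \<le> (2 * \<epsilon> / s)\<^sup>2"
    and Hp: "\<And>i. (\<Sum>k\<in>UNIV. H i k * p k) = P * \<sigma> i"
    and L: "L \<le> P * (\<epsilon>\<^sup>2 * (32 + 4 * real CARD('n)) / s\<^sup>2)"
  shows "A * (L - 2 * (\<Sum>i\<in>UNIV. \<Sum>k\<in>UNIV. (H i k)\<^sup>2)) + 2 * B * (\<Sum>k\<in>UNIV. p k * (2 * P * \<sigma> k))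
      + 2 * A' * P * (\<Sum>i\<in>UNIV. H i i) + 2 * B' * P\<^sup>2
    \<le> - (\<kappa> - \<epsilon>) * P\<^sup>2 + (K * (32 + 4 * real CARD('n)) + 36 * K\<^sup>2) * \<epsilon> * P / s\<^sup>2"
proof -
  define n where "n = real CARD('n)"
  define h where "h = (\<Sum>i\<in>UNIV. \<Sum>k\<in>UNIV. (H i k)\<^sup>2)"
  define \<tau> where "\<tau> = (\<Sum>i\<in>UNIV. H i i)"
  define q where "q = (\<Sum>k\<in>UNIV. p k * \<sigma> k)"
  \<comment> \<open>Since p H p = P q, the component of the trace along p is q, and X is P times the
    trace over the orthogonal complement of p. The remainder q is an error of order
    \<epsilon>.\<close>
  define X where "X = P * \<tau> - P * q"
  define y where "y = sqrt P"
  have y: "y > 0" "P = y\<^sup>2" using P by (auto simp: y_def)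
  have K: "K > 0" using A by simp
  have n: "n \<ge> 1" by (simp add: n_def Suc_le_eq)
  have h: "h \<ge> 0" unfolding h_def by (intro sum_nonneg) auto
  have "X\<^sup>2 \<le> (n - 1) * P\<^sup>2 * h"
  proof -
    have "(\<Sum>i\<in>UNIV. p i * (\<Sum>k\<in>UNIV. H i k * p k)) = P * q"
      unfolding Hp q_def sum_distrib_left by (simp add: mult_ac)
    then show ?thesis
      using trace_orthogonal_bound[of p H] by (simp add: X_def \<tau>_def n_def h_def P_def)
  qed
  then have X: "2 * A' * X - 2 * A * h \<le> (n - 1) * A'\<^sup>2 / (2 * A) * P\<^sup>2"
  proof -
    define c where "c = sqrt (n - 1) * P"
    have "X\<^sup>2 \<le> (c * sqrt h)\<^sup>2"
      using \<open>X\<^sup>2 \<le> _\<close> n h by (simp add: c_def power_mult_distrib)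
    then have "\<bar>X\<bar> \<le> c * sqrt h"
      using n P h by (metis abs_le_square_iff abs_of_nonneg c_def mult_nonneg_nonneg real_sqrt_ge_zero
          diff_ge_0_iff_ge less_imp_le)
    then have "A' * X \<le> \<bar>A'\<bar> * (c * sqrt h)"
      by (metis abs_ge_self abs_ge_zero abs_mult mult_left_mono order_trans)
    \<comment> \<open>Completing the square in \<open>sqrt h\<close>: the good term - 2 A |H|^2 pays
      for the Laplacian term.\<close>
    moreover have "2 * (\<bar>A'\<bar> * (c * sqrt h)) - 2 * A * h \<le> (\<bar>A'\<bar> * c)\<^sup>2 / (2 * A)"
    proof -
      have "0 \<le> (2 * A * sqrt h - \<bar>A'\<bar> * c)\<^sup>2" by simp
      also have "\<dots> = 4 * A\<^sup>2 * h + (\<bar>A'\<bar> * c)\<^sup>2 - 4 * A * (\<bar>A'\<bar> * (c * sqrt h))"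
        using h by (simp add: power2_diff power_mult_distrib algebra_simps)
      finally show ?thesis using A by (simp add: field_simps power2_eq_square)
    qed
    moreover have "(\<bar>A'\<bar> * c)\<^sup>2 / (2 * A) = (n - 1) * A'\<^sup>2 / (2 * A) * P\<^sup>2"
      using n by (simp add: c_def power_mult_distrib)
    ultimately show ?thesis by simp
  qed
  have "q\<^sup>2 \<le> P * (2 * \<epsilon> / s)\<^sup>2"
  proof -
    have "q\<^sup>2 \<le> (\<Sum>k\<in>UNIV. (p k)\<^sup>2) * (\<Sum>k\<in>UNIV. (\<sigma> k)\<^sup>2)"
      unfolding q_def by (rule Cauchy_Schwarz_ineq_sum)
    also have "\<dots> = P * (\<Sum>k\<in>UNIV. \<sigma> k * \<sigma> k)"
      by (simp add: P_def power2_eq_square)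
    also have "\<dots> \<le> P * (2 * \<epsilon> / s)\<^sup>2"
      using \<sigma> P by (intro mult_left_mono) auto
    finally show ?thesis .
  qed
  then have "q\<^sup>2 \<le> (y * (2 * \<epsilon> / s))\<^sup>2" by (simp only: y power_mult_distrib)
  then have q: "\<bar>q\<bar> \<le> y * (2 * \<epsilon> / s)"
    using y s e by (simp add: abs_le_square_iff[symmetric])
  have pq: "(\<Sum>k\<in>UNIV. p k * (2 * P * \<sigma> k)) = 2 * P * q"
    by (simp add: q_def sum_distrib_left mult_ac)
  \<comment> \<open>With P = y^2 the left side has size 12 K \<epsilon> y^3 / s, and y * 12 K / s <=
    y^2 + 36 K^2 / s^2. The first part is charged to \<kappa> P^2; the second is linear in P with
    weight 1 / s^2, which suits a maximum of s^2 P.\<close>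
  have "(4 * B + 2 * A') * P * q \<le> \<epsilon> * P\<^sup>2 + 36 * K\<^sup>2 * \<epsilon> * P / s\<^sup>2"
  proof -
    have "(4 * B + 2 * A') * P * q \<le> \<bar>4 * B + 2 * A'\<bar> * P * \<bar>q\<bar>"
      using P abs_ge_self[of "(4 * B + 2 * A') * P * q"] by (simp add: abs_mult)
    also have "\<dots> \<le> (6 * K) * P * (y * (2 * \<epsilon> / s))"
      using A' B P q K by (intro mult_mono) auto
    also have "\<dots> = \<epsilon> * P\<^sup>2 + 36 * K\<^sup>2 * \<epsilon> * P / s\<^sup>2 - \<epsilon> * y\<^sup>2 * (y - 6 * K / s)\<^sup>2"
      using s by (simp add: y field_simps power2_eq_square)
    also have "\<dots> \<le> \<epsilon> * P\<^sup>2 + 36 * K\<^sup>2 * \<epsilon> * P / s\<^sup>2" using e by simp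
    finally show ?thesis .
  qed
  moreover have "A * L \<le> K * (32 + 4 * n) * \<epsilon> * P / s\<^sup>2"
  proof -
    have "A * L \<le> A * (P * (\<epsilon>\<^sup>2 * (32 + 4 * n) / s\<^sup>2))"
      unfolding n_def using L A by (intro mult_left_mono) auto
    also have "\<dots> \<le> K * (P * (\<epsilon> * (32 + 4 * n) / s\<^sup>2))"
      using A P e n by (intro mult_mono divide_right_mono) (auto simp: power2_eq_square mult_le_cancel_right1)
    finally show ?thesis by (simp add: mult_ac)
  qed
  moreover have "2 * B' * P\<^sup>2 + (n - 1) * A'\<^sup>2 / (2 * A) * P\<^sup>2 \<le> - \<kappa> * P\<^sup>2"
  proof -
    have "(2 * B' + (n - 1) * A'\<^sup>2 / (2 * A)) * P\<^sup>2 \<le> - \<kappa> * P\<^sup>2"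
      using k by (intro mult_right_mono) (auto simp: n_def)
    then show ?thesis by (simp only: distrib_right)
  qed
  moreover have "A * (L - 2 * h) + 2 * B * (2 * P * q) + 2 * A' * P * \<tau> + 2 * B' * P\<^sup>2
      = A * L + (2 * A' * X - 2 * A * h) + (4 * B + 2 * A') * P * q + 2 * B' * P\<^sup>2"
    by (simp add: X_def algebra_simps)
  moreover have "- (\<kappa> - \<epsilon>) * P\<^sup>2 + (K * (32 + 4 * n) + 36 * K\<^sup>2) * \<epsilon> * P / s\<^sup>2
      = - \<kappa> * P\<^sup>2 + (\<epsilon> * P\<^sup>2 + 36 * K\<^sup>2 * \<epsilon> * P / s\<^sup>2) + K * (32 + 4 * n) * \<epsilon> * P / s\<^sup>2"
    by (simp add: algebra_simps add_divide_distrib)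
  ultimately show ?thesis
    using X unfolding pq h_def[symmetric] \<tau>_def[symmetric] n_def[symmetric] by linarith
qed

section \<open>Gradient estimate by cutoff\<close>

text \<open>If c were positive, g would be positive just to the right of 0, and f would increase
  there beyond its maximum.\<close>

lemma local_max_derivs:
  fixes f g :: "real \<Rightarrow> real"
  assumes d: "d > 0"
    and f: "\<And>r. \<bar>r\<bar> < d \<Longrightarrow> (f has_real_derivative g r) (at r)"
    and g: "(g has_real_derivative c) (at 0)"
    and max: "\<And>r. \<bar>r\<bar> < d \<Longrightarrow> f r \<le> f 0"
  shows "g 0 = 0" and "c \<le> 0"
proof -
  show g0: "g 0 = 0"
    by (rule DERIV_local_max[OF f d]) (use d max in auto)
  show "c \<le> 0"
  proof (rule ccontr)
    assume "\<not> c \<le> 0"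
    then obtain d' where d': "d' > 0" "\<And>h. h > 0 \<Longrightarrow> h < d' \<Longrightarrow> g h > g 0"
      using DERIV_pos_inc_right[OF g] by auto
    define h where "h = min d d' / 2"
    have h: "0 < h" "h < d" "h < d'" using d d' by (auto simp: h_def)
    have "f 0 < f h"
    proof (rule DERIV_pos_imp_increasing_open[OF h(1)])
      show "\<exists>y. (f has_real_derivative y) (at x) \<and> y > 0" if "0 < x" "x < h" for x
        using f[of x] d'(2)[of x] g0 h that by auto
      show "continuous_on {0..h} f"
        by (intro continuous_at_imp_continuous_on ballI, rule DERIV_isCont[OF f]) (use h in auto)
    qed
    then show False using max[of h] h by simp
  qed
qed

text \<open>One-sided, because a maximum over a time interval may be attained at its right
  end.\<close>

lemma left_max_deriv_nonneg:
  fixes f :: "real \<Rightarrow> real"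
  assumes "(f has_real_derivative c) (at b)" "a < b" "\<And>r. a < r \<Longrightarrow> r < b \<Longrightarrow> f r \<le> f b"
  shows "c \<ge> 0"
proof (rule ccontr)
  assume "\<not> c \<ge> 0"
  then obtain d where d: "d > 0" "\<And>h. h > 0 \<Longrightarrow> h < d \<Longrightarrow> f (b - h) > f b"
    using DERIV_neg_dec_left[OF assms(1)] by auto
  define h where "h = min d (b - a) / 2"
  have "0 < h" "h < d" "h < b - a" using d assms(2) by (auto simp: h_def)
  then show False using d(2)[of h] assms(3)[of "b - h"] by auto
qed

lemma sum_power2_vec: "(\<Sum>i\<in>UNIV. (y $ i)\<^sup>2) = (norm (y :: real^'n))\<^sup>2"
  by (simp add: norm_vec_def L2_set_def sum_nonneg)

lemma norm_add_axis_power2: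
  "(norm (y + r *\<^sub>R axis i 1 :: real^'n))\<^sup>2 = (norm y)\<^sup>2 + 2 * r * y $ i + r\<^sup>2"
  by (simp only: power2_norm_eq_inner)
    (simp add: inner_add_left inner_add_right inner_axis inner_axis' inner_commute power2_eq_square
      algebra_simps)

text \<open>The function (t - \<tau>) s^2 P vanishes at time \<tau> and on the lateral boundary of
  the cylinder, so a positive maximum lies in the spatial interior, possibly at the final time.
  Starting at \<tau> > 0 keeps the cylinder inside the open set \<open>S\<close>. A single parameter
  \<epsilon> governs the radius 1 / \<epsilon>, the start \<epsilon> t and the share of \<kappa>
  spent on the cutoff; all these losses vanish in the limit.\<close>

theorem gradient_estimate:
  fixes w A B A' B' :: "real \<times> (real^'n) \<Rightarrow> real" and T :: real
  defines "S \<equiv> {0<..<T} \<times> (UNIV :: (real^'n) set)"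
  assumes w: "smooth_on S w" and A: "smooth_on S A" and B: "smooth_on S B"
    and pde: "\<And>z. z \<in> S \<Longrightarrow> dt w z = A z * lap w z + B z * gradsq w z"
    and A': "\<And>z k. z \<in> S \<Longrightarrow> dx k A z = A' z * dx k w z"
    and B': "\<And>z k. z \<in> S \<Longrightarrow> dx k B z = B' z * dx k w z"
    and Apos: "\<And>z. z \<in> S \<Longrightarrow> 0 < A z" and AK: "\<And>z. z \<in> S \<Longrightarrow> A z \<le> K"
    and A'K: "\<And>z. z \<in> S \<Longrightarrow> \<bar>A' z\<bar> \<le> K" and BK: "\<And>z. z \<in> S \<Longrightarrow> \<bar>B z\<bar> \<le> K"
    and \<kappa>: "\<And>z. z \<in> S \<Longrightarrow>
      2 * B' z + (real CARD('n) - 1) * (A' z)\<^sup>2 / (2 * A z) \<le> - \<kappa>" "\<kappa> > 0"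
    and t: "0 < t" "t < T"
  shows "\<kappa> * t * gradsq w (t, x) \<le> 1"
proof -
  define n where "n = real CARD('n)"
  \<comment> \<open>The two summands are the errors in \<open>bernstein_absorption\<close>: the
    Laplacian of P at the maximum, and the first order terms containing \<sigma>.\<close>
  define C where "C = K * (32 + 4 * n) + 36 * K\<^sup>2"
  define P where "P = gradsq w"
  have S: "open S" unfolding S_def by (intro open_Times) auto
  have T: "T > 0" using t by simp
  have "(t, x) \<in> S" using t by (auto simp: S_def)
  then have K: "K > 0" using Apos AK by fastforce
  then have C: "C \<ge> 0" by (simp add: C_def n_def)
  have P: "smooth_on S P" "\<And>z. P z \<ge> 0"
    using smooth_on_gradsq[OF w S] by (auto simp: P_def gradsq_nonneg)
  have approx: "(\<kappa> - \<epsilon>) * ((t - \<epsilon> * t) * P (t, x)) \<le> 1 + T * C * \<epsilon>"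
    if \<epsilon>: "0 < \<epsilon>" "\<epsilon> < 1" "\<epsilon> < \<kappa>" for \<epsilon>
  proof -
    define \<tau> where "\<tau> = \<epsilon> * t"
    have \<tau>: "0 < \<tau>" "\<tau> < t" using \<epsilon> t by (auto simp: \<tau>_def)
    define s where "s y = 1 - \<epsilon>\<^sup>2 * (norm (y - x))\<^sup>2" for y
    define Z where "Z z = (fst z - \<tau>) * (s (snd z))\<^sup>2 * P z" for z
    define Q where "Q = {\<tau>..t} \<times> cball x (1 / \<epsilon>)"
    have "compact Q" unfolding Q_def by (intro compact_Times) auto
    moreover have "Q \<noteq> {}" using \<tau> \<epsilon> by (auto simp: Q_def intro!: exI[of _ t] exI[of _ x])
    moreover have "continuous_on Q Z"
    proof -
      have "Q \<subseteq> S" using \<tau> t by (auto simp: Q_def S_def)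
      then have "continuous_on Q P"
        using smooth_on_continuous_on[OF P(1)] continuous_on_subset by blast
      then show ?thesis unfolding Z_def s_def by (intro continuous_intros)
    qed
    ultimately obtain z1 where z1: "z1 \<in> Q" "\<And>z. z \<in> Q \<Longrightarrow> Z z \<le> Z z1"
      using continuous_attains_sup[of Q Z] by blast
    obtain t1 x1 where z1_eq: "z1 = (t1, x1)" by (cases z1)
    have tx: "(t, x) \<in> Q" using \<tau> \<epsilon> by (auto simp: Q_def)
    have "(\<kappa> - \<epsilon>) * Z z1 \<le> 1 + T * C * \<epsilon>"
    proof (cases "Z z1 \<le> 0")
      case True
      then have "(\<kappa> - \<epsilon>) * Z z1 \<le> 0" using \<epsilon> by (intro mult_nonneg_nonpos) auto
      moreover have "0 \<le> T * C * \<epsilon>" using T C \<epsilon> by simp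
      ultimately show ?thesis by linarith
    next
      case False
      define \<sigma> where "\<sigma> i = 2 * \<epsilon>\<^sup>2 * (x1 - x) $ i / s x1" for i
      define p where "p k = dx k w z1" for k
      define H where "H i k = dx i (dx k w) z1" for i k
      have z1S: "z1 \<in> S" using z1(1) \<tau> t by (auto simp: Q_def S_def)
      \<comment> \<open>A positive value of Z excludes the zeros of each of its three
        factors.\<close>
      have t1: "\<tau> < t1" "t1 \<le> t" and "x1 \<in> cball x (1 / \<epsilon>)"
        and s1_nz: "s x1 \<noteq> 0" and P1: "P z1 > 0"
        using False z1(1) P(2)[of z1] by (auto simp: Q_def Z_def z1_eq less_le)
      then have "norm (x1 - x) * \<epsilon> \<le> 1"
        using \<epsilon> by (simp add: dist_norm norm_minus_commute field_simps)
      then have "(norm (x1 - x) * \<epsilon>)\<^sup>2 \<le> 1"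
        using \<epsilon> by (simp add: power_le_one)
      then have nx: "\<epsilon>\<^sup>2 * (norm (x1 - x))\<^sup>2 \<le> 1" by (simp add: power_mult_distrib mult.commute)
      then have s1: "0 < s x1" "s x1 \<le> 1" using s1_nz by (auto simp: s_def)
      then have "\<epsilon>\<^sup>2 * (norm (x1 - x))\<^sup>2 < 1" by (simp add: s_def)
      then have "(\<epsilon> * norm (x1 - x))\<^sup>2 < 1\<^sup>2" by (simp add: power_mult_distrib)
      then have "\<epsilon> * norm (x1 - x) < 1" by (rule power_less_imp_less_base) simp
      then have "x1 \<in> ball x (1 / \<epsilon>)"
        using \<epsilon> by (simp add: dist_norm norm_minus_commute field_simps)
      then obtain d where d: "d > 0" "ball x1 d \<subseteq> ball x (1 / \<epsilon>)"
        using open_contains_ball[of "ball x (1 / \<epsilon>)"] open_ball by blast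
      have time: "P z1 + (t1 - \<tau>) * dt P z1 \<ge> 0"
      proof -
        have line: "((\<lambda>r. P ((0, x1) + r *\<^sub>R (1, 0))) has_real_derivative dt P z1) (at t1)"
          using dd_line[OF P(1) S, of "(0, x1)" t1 "(1, 0)"] z1S by (simp add: z1_eq)
        have "((\<lambda>r. (r - \<tau>) * P (r, x1)) has_real_derivative
            (1 * P (t1, x1) + (t1 - \<tau>) * dt P z1)) (at t1)"
          using line by (auto intro!: derivative_eq_intros)
        then have "0 \<le> 1 * P (t1, x1) + (t1 - \<tau>) * dt P z1"
        proof (rule left_max_deriv_nonneg[OF _ t1(1)])
          fix r assume r: "\<tau> < r" "r < t1"
          then have "Z (r, x1) \<le> Z z1"
            using z1 t1 by (intro z1(2)) (auto simp: Q_def z1_eq)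
          then have "(s x1)\<^sup>2 * ((r - \<tau>) * P (r, x1)) \<le> (s x1)\<^sup>2 * ((t1 - \<tau>) * P (t1, x1))"
            by (simp add: Z_def z1_eq mult_ac)
          then show "(r - \<tau>) * P (r, x1) \<le> (t1 - \<tau>) * P (t1, x1)"
            using s1 by simp
        qed
        then show ?thesis by (simp add: z1_eq)
      qed
      \<comment> \<open>First and second order conditions for s^2 P along the coordinate line. The
        computation yields the factor 6; it is rounded up to 8, which times (2 \<epsilon> / s)^2
        gives the 32 in C.\<close>
      have space: "dx i P z1 = 2 * P z1 * \<sigma> i"
        "dx i (dx i P) z1 \<le> P z1 * (8 * (\<sigma> i * \<sigma> i) + 4 * \<epsilon>\<^sup>2 / s x1)" for i
      proof -
        define \<xi> where "\<xi> = (x1 - x) $ i"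
        define S0 where "S0 r = s x1 - \<epsilon>\<^sup>2 * (2 * r * \<xi> + r\<^sup>2)" for r
        define L where "L r = z1 + r *\<^sub>R (0, axis i 1)" for r
        have L: "L r \<in> S" "L r = (t1, x1 + r *\<^sub>R axis i 1)" for r
          using z1S by (auto simp: L_def S_def z1_eq)
        have S0: "S0 r = s (x1 + r *\<^sub>R axis i 1)" for r
        proof -
          have "x1 + r *\<^sub>R axis i 1 - x = (x1 - x) + r *\<^sub>R axis i 1" by simp
          then show ?thesis
            by (simp only: S0_def s_def \<xi>_def norm_add_axis_power2) (simp add: algebra_simps)
        qed
        have dP: "((\<lambda>r. P (L r)) has_real_derivative dx i P (L r)) (at r)" for r
          unfolding L_def using L(1) by (intro dd_line[OF P(1) S]) (simp add: L_def)
        have ddP: "((\<lambda>r. dx i P (L r)) has_real_derivative dx i (dx i P) (L r)) (at r)" for r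
          unfolding L_def using L(1) by (intro dd_line[OF smooth_on_dd[OF P(1) S] S]) (simp add: L_def)
        have dS0: "(S0 has_real_derivative - 2 * \<epsilon>\<^sup>2 * (\<xi> + r)) (at r)" for r
          unfolding S0_def by (auto intro!: derivative_eq_intros simp: algebra_simps)
        \<comment> \<open>Along the line the time factor of Z is constant and is dropped; g is the
          derivative of f, and c is the second derivative at 0.\<close>
        define f where "f r = (S0 r)\<^sup>2 * P (L r)" for r
        define g where "g r = 2 * S0 r * (- 2 * \<epsilon>\<^sup>2 * (\<xi> + r)) * P (L r) + (S0 r)\<^sup>2 * dx i P (L r)" for r
        define c where "c = 8 * \<epsilon>^4 * \<xi>\<^sup>2 * P z1 - 4 * \<epsilon>\<^sup>2 * s x1 * P z1
            - 8 * \<epsilon>\<^sup>2 * \<xi> * s x1 * dx i P z1 + (s x1)\<^sup>2 * dx i (dx i P) z1"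
        have L0: "L 0 = z1" "S0 0 = s x1" by (auto simp: L_def S0_def zero_prod_def[symmetric])
        have fg: "(f has_real_derivative g r) (at r)" for r
          unfolding f_def g_def
          by (auto intro!: derivative_eq_intros dP dS0 simp: algebra_simps power2_eq_square)
        have gc: "(g has_real_derivative c) (at 0)"
          unfolding g_def
          apply (rule derivative_eq_intros dP ddP dS0 refl)+
          apply (simp add: L0 c_def algebra_simps power2_eq_square power4_eq_xxxx)
          done
        have max: "f r \<le> f 0" if "\<bar>r\<bar> < d" for r
        proof -
          have "x1 + r *\<^sub>R axis i 1 \<in> cball x (1 / \<epsilon>)"
            using that d by (intro subsetD[OF ball_subset_cball] subsetD[OF d(2)])
              (auto simp: dist_norm norm_axis_1)
          then have "Z (L r) \<le> Z z1"
            using z1 t1 by (intro z1(2)) (auto simp: Q_def L(2))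
          then have "(t1 - \<tau>) * f r \<le> (t1 - \<tau>) * f 0"
            using S0[of r] by (simp add: Z_def f_def L0 L(2) z1_eq mult_ac S0_def)
          then show ?thesis using t1 by simp
        qed
        have g0: "g 0 = 0" and c0: "c \<le> 0"
          by (rule local_max_derivs[OF d(1) fg gc max]; assumption)+
        have sig: "\<sigma> i * s x1 = 2 * \<epsilon>\<^sup>2 * \<xi>" using s1 by (simp add: \<sigma>_def \<xi>_def)
        have "s x1 * (s x1 * (dx i P z1 - 2 * P z1 * \<sigma> i))
            = (s x1)\<^sup>2 * dx i P z1 - 2 * s x1 * (\<sigma> i * s x1) * P z1"
          by (simp add: algebra_simps power2_eq_square)
        also have "\<dots> = g 0"
          unfolding sig by (simp add: g_def L0)
        finally show dP1: "dx i P z1 = 2 * P z1 * \<sigma> i"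
          using g0 s1 by simp
        have "c = 2 * (2 * \<epsilon>\<^sup>2 * \<xi>)\<^sup>2 * P z1 - 4 * \<epsilon>\<^sup>2 * s x1 * P z1
            - 4 * (2 * \<epsilon>\<^sup>2 * \<xi>) * s x1 * dx i P z1 + (s x1)\<^sup>2 * dx i (dx i P) z1"
          by (simp add: c_def power2_eq_square power4_eq_xxxx)
        also have "\<dots> = (s x1)\<^sup>2 * dx i (dx i P) z1
            - (s x1)\<^sup>2 * (P z1 * (6 * (\<sigma> i * \<sigma> i) + 4 * \<epsilon>\<^sup>2 / s x1))"
          unfolding sig[symmetric] dP1 using s1 by (simp add: field_simps power2_eq_square)
        finally have "(s x1)\<^sup>2 * dx i (dx i P) z1
            \<le> (s x1)\<^sup>2 * (P z1 * (6 * (\<sigma> i * \<sigma> i) + 4 * \<epsilon>\<^sup>2 / s x1))"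
          using c0 by simp
        then have "dx i (dx i P) z1 \<le> P z1 * (6 * (\<sigma> i * \<sigma> i) + 4 * \<epsilon>\<^sup>2 / s x1)"
          using s1 by simp
        also have "\<dots> \<le> P z1 * (8 * (\<sigma> i * \<sigma> i) + 4 * \<epsilon>\<^sup>2 / s x1)"
          using P1 by (intro mult_left_mono add_right_mono mult_right_mono) auto
        finally show "dx i (dx i P) z1 \<le> P z1 * (8 * (\<sigma> i * \<sigma> i) + 4 * \<epsilon>\<^sup>2 / s x1)" .
      qed
      have \<sigma>: "(\<Sum>k\<in>UNIV. \<sigma> k * \<sigma> k) \<le> (2 * \<epsilon> / s x1)\<^sup>2"
      proof -
        have "(\<Sum>k\<in>UNIV. \<sigma> k * \<sigma> k) = (\<Sum>k\<in>UNIV. (2 * \<epsilon>\<^sup>2 / s x1)\<^sup>2 * ((x1 - x) $ k)\<^sup>2)"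
          by (intro sum.cong) (auto simp: \<sigma>_def power2_eq_square)
        also have "\<dots> = (2 * \<epsilon>\<^sup>2 / s x1)\<^sup>2 * (norm (x1 - x))\<^sup>2"
          by (simp only: sum_distrib_left[symmetric] sum_power2_vec)
        also have "\<dots> = (2 * \<epsilon> / s x1)\<^sup>2 * (\<epsilon>\<^sup>2 * (norm (x1 - x))\<^sup>2)"
          by (simp add: power2_eq_square)
        also have "\<dots> \<le> (2 * \<epsilon> / s x1)\<^sup>2 * 1"
          using nx by (intro mult_left_mono) auto
        finally show ?thesis by simp
      qed
      have lapP: "lap P z1 \<le> P z1 * (\<epsilon>\<^sup>2 * (32 + 4 * n) / (s x1)\<^sup>2)"
      proof -
        have "lap P z1 \<le> (\<Sum>i\<in>UNIV. P z1 * (8 * (\<sigma> i * \<sigma> i) + 4 * \<epsilon>\<^sup>2 / s x1))"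
          unfolding lap_def by (intro sum_mono space)
        also have "\<dots> = P z1 * (8 * (\<Sum>i\<in>UNIV. \<sigma> i * \<sigma> i) + n * (4 * \<epsilon>\<^sup>2 / s x1))"
          by (simp only: sum_distrib_left[symmetric] sum.distrib sum_constant n_def)
        also have "\<dots> \<le> P z1 * (8 * (2 * \<epsilon> / s x1)\<^sup>2 + n * (4 * \<epsilon>\<^sup>2 / (s x1)\<^sup>2))"
          using P1 \<sigma> s1
          by (intro mult_left_mono add_mono divide_left_mono)
            (auto simp: n_def power2_eq_square mult_le_cancel_right1)
        also have "\<dots> = P z1 * (\<epsilon>\<^sup>2 * (32 + 4 * n) / (s x1)\<^sup>2)"
          by (simp add: power_divide power_mult_distrib algebra_simps add_divide_distrib)
        finally show ?thesis .
      qed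
      have Hp: "(\<Sum>k\<in>UNIV. H i k * p k) = P z1 * \<sigma> i" for i
      proof -
        have "2 * (\<Sum>k\<in>UNIV. H i k * p k) = dx i P z1"
          unfolding P_def using dd_gradsq[OF w S z1S]
          by (simp add: H_def p_def sum_distrib_left mult_ac)
        then show ?thesis using space(1)[of i] by simp
      qed
      have Pp: "P z1 = (\<Sum>k\<in>UNIV. p k * p k)" by (simp add: P_def p_def gradsq_def)
      have "dt P z1 \<le> - (\<kappa> - \<epsilon>) * (P z1)\<^sup>2 + C * \<epsilon> * P z1 / (s x1)\<^sup>2"
      proof -
        have "dt P z1 = A z1 * (lap P z1 - 2 * (\<Sum>i\<in>UNIV. \<Sum>k\<in>UNIV. (H i k)\<^sup>2))
            + 2 * B z1 * (\<Sum>k\<in>UNIV. p k * (2 * P z1 * \<sigma> k))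
            + 2 * A' z1 * P z1 * (\<Sum>i\<in>UNIV. H i i) + 2 * B' z1 * (P z1)\<^sup>2"
          using bernstein_identity[OF w A B S z1S pde A'[OF z1S] B'[OF z1S]]
          unfolding P_def[symmetric] space(1) by (simp add: H_def p_def lap_def[of w])
        also have "\<dots> \<le> - (\<kappa> - \<epsilon>) * (P z1)\<^sup>2 + C * \<epsilon> * P z1 / (s x1)\<^sup>2"
          unfolding C_def n_def Pp
          by (rule bernstein_absorption)
            (use P1 s1 \<epsilon> Apos AK A'K BK \<kappa> \<sigma> Hp lapP z1S Pp in \<open>auto simp: n_def\<close>)
        finally show ?thesis .
      qed
      then have "(t1 - \<tau>) * dt P z1 \<le> (t1 - \<tau>) * (- (\<kappa> - \<epsilon>) * (P z1)\<^sup>2 + C * \<epsilon> * P z1 / (s x1)\<^sup>2)"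
        using t1 by (intro mult_left_mono) auto
      then have "0 \<le> P z1 + (t1 - \<tau>) * (- (\<kappa> - \<epsilon>) * (P z1)\<^sup>2 + C * \<epsilon> * P z1 / (s x1)\<^sup>2)"
        using time by linarith
      \<comment> \<open>The error carries 1 / s^2, so extracting P / s^2 turns \<kappa> P^2 into
        \<kappa> Z and leaves only bounded terms.\<close>
      also have "\<dots> = P z1 / (s x1)\<^sup>2 * ((s x1)\<^sup>2 + (t1 - \<tau>) * C * \<epsilon> - (\<kappa> - \<epsilon>) * Z z1)"
        using s1 by (simp add: Z_def z1_eq field_simps power2_eq_square)
      finally have "(\<kappa> - \<epsilon>) * Z z1 \<le> (s x1)\<^sup>2 + (t1 - \<tau>) * C * \<epsilon>"
        using P1 s1 by (simp add: zero_le_mult_iff zero_le_divide_iff)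
      moreover have "(s x1)\<^sup>2 \<le> 1" using s1 by (simp add: power_le_one)
      moreover have "(t1 - \<tau>) * C * \<epsilon> \<le> T * C * \<epsilon>"
        using t1 \<tau> t C \<epsilon> by (intro mult_right_mono) auto
      ultimately show ?thesis by linarith
    qed
    \<comment> \<open>At the centre x the cutoff equals 1.\<close>
    moreover have "(t - \<tau>) * P (t, x) \<le> Z z1"
      using z1(2)[OF tx] by (simp add: Z_def s_def)
    then have "(\<kappa> - \<epsilon>) * ((t - \<tau>) * P (t, x)) \<le> (\<kappa> - \<epsilon>) * Z z1"
      using \<epsilon> by (intro mult_left_mono) auto
    ultimately show ?thesis by (simp add: \<tau>_def)
  qed
  have "(\<kappa> - 0) * ((t - 0 * t) * P (t, x)) \<le> 1 + T * C * 0"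
  proof (rule tendsto_le)
    show "((\<lambda>\<epsilon>. (\<kappa> - \<epsilon>) * ((t - \<epsilon> * t) * P (t, x))) \<longlongrightarrow>
        (\<kappa> - 0) * ((t - 0 * t) * P (t, x))) (at_right 0)"
      by (intro tendsto_intros)
    show "((\<lambda>\<epsilon>. 1 + T * C * \<epsilon>) \<longlongrightarrow> 1 + T * C * 0) (at_right 0)"
      by (intro tendsto_intros)
    have "eventually (\<lambda>\<epsilon>. 0 < \<epsilon> \<and> \<epsilon> < min 1 \<kappa>) (at_right (0::real))"
      using eventually_at_right_real[of 0 "min 1 \<kappa>"] \<kappa>(2) by simp
    then show "eventually (\<lambda>\<epsilon>. (\<kappa> - \<epsilon>) * ((t - \<epsilon> * t) * P (t, x)) \<le> 1 + T * C * \<epsilon>) (at_right 0)"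
      by eventually_elim (use approx in auto)
  qed simp
  then show ?thesis by (simp add: P_def mult_ac)
qed

section \<open>Change of the dependent variable and comparison principles\<close>

lemma partial_deriv_eq_dx:
  assumes "smooth_on S f" "open S" "(t, x) \<in> S"
  shows "partial_deriv i (\<lambda>y. f (t, y)) x = dx i f (t, x)"
  using dd_line[of S f "(t, x)" 0 "(0, axis i 1)"] assms
  by (auto simp: partial_deriv_def intro: DERIV_imp_deriv)

lemma laplacian_eq_lap:
  assumes "smooth_on S f" "open S" "\<And>y. (t, y) \<in> S"
  shows "laplacian (\<lambda>y. f (t, y)) x = lap f (t, x)"
proof -
  have "partial_deriv i (\<lambda>y. f (t, y)) = (\<lambda>y. dx i f (t, y))" for i
    using assms by (intro ext partial_deriv_eq_dx)
  then show ?thesis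
    unfolding laplacian_def lap_def
    using partial_deriv_eq_dx[OF smooth_on_dd[OF assms(1,2)] assms(2,3)] by simp
qed

lemma dd_compose_on:
  fixes F G :: "real \<Rightarrow> real"
  assumes "smooth_on S v" "open S" "z \<in> S" "v ` S \<subseteq> J"
    and "\<And>r. r \<in> J \<Longrightarrow> (F has_real_derivative G r) (at r within J)"
  shows "dd e (\<lambda>z. F (v z)) z = G (v z) * dd e v z"
  using assms by (intro dd_compose[where S = S and J = J]) auto

lemma gradsq_compose:
  fixes F G :: "real \<Rightarrow> real"
  assumes "smooth_on S v" "open S" "z \<in> S" "v ` S \<subseteq> J"
    and "\<And>r. r \<in> J \<Longrightarrow> (F has_real_derivative G r) (at r within J)"
  shows "gradsq (\<lambda>z. F (v z)) z = (G (v z))\<^sup>2 * gradsq v z"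
  unfolding gradsq_def using dd_compose_on[OF assms]
  by (simp add: sum_distrib_left power2_eq_square mult_ac)

lemma lap_compose:
  fixes F G g :: "real \<Rightarrow> real"
  assumes v: "smooth_on S v" "open S" "z \<in> S" "v ` S \<subseteq> J"
    and F: "\<And>r. r \<in> J \<Longrightarrow> (F has_real_derivative G r) (at r within J)"
    and G: "\<And>r. r \<in> J \<Longrightarrow> (G has_real_derivative g r) (at r within J)"
    and sG: "smooth_on J G"
  shows "lap (\<lambda>z. F (v z)) z = G (v z) * lap v z + g (v z) * gradsq v z"
proof -
  have "dx i (dx i (\<lambda>z. F (v z))) z = G (v z) * dx i (dx i v) z + g (v z) * (dx i v z * dx i v z)" for i
  proof -
    have "dx i (dx i (\<lambda>z. F (v z))) z = dx i (\<lambda>z. G (v z) * dx i v z) z"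
      using dd_compose_on[OF v(1,2) _ v(4) F] v by (intro dd_cong[where S = S]) auto
    also have "\<dots> = G (v z) * dx i (dx i v) z + dx i (\<lambda>z. G (v z)) z * dx i v z"
      by (rule dd_mult[OF smooth_on_compose[OF sG v(1,4)] smooth_on_dd[OF v(1,2)] v(2,3)])
    also have "dx i (\<lambda>z. G (v z)) z = g (v z) * dx i v z"
      by (rule dd_compose_on[OF v G])
    finally show ?thesis by simp
  qed
  then show ?thesis
    by (simp add: lap_def gradsq_def sum.distrib sum_distrib_left)
qed

lemma smooth_on_powr_const: "smooth_on {0<..} (\<lambda>r::real. c * r powr a)"
  by (intro smooth_on_mult smooth_on_const) (simp add: smooth_on_def Ck_on_powr)

text \<open>The chain rules are solved for \<open>lap v\<close> and \<open>gradsq v\<close>, whence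
  the divisions by G. The formula serves three substitutions: a small power for the lower bound,
  \<open>- 1 * v z powr m\<close> for the upper bound, and the primitive of the weight for the
  gradient estimate.\<close>

lemma transformed_pde:
  fixes W G g :: "real \<Rightarrow> real"
  assumes v: "smooth_on S v" "open S" "z \<in> S" "v ` S \<subseteq> J" and J: "J \<subseteq> {0<..}"
    and pde: "dt v z = lap (\<lambda>z. v z powr m) z"
    and W: "\<And>r. r \<in> J \<Longrightarrow> (W has_real_derivative G r) (at r within J)"
    and G: "\<And>r. r \<in> J \<Longrightarrow> (G has_real_derivative g r) (at r within J)" "smooth_on J G"
    and nz: "G (v z) \<noteq> 0"
  shows "dt (\<lambda>z. W (v z)) z = m * v z powr (m - 1) * lap (\<lambda>z. W (v z)) z
    + (m * (m - 1) * v z powr (m - 2) - m * v z powr (m - 1) * g (v z) / G (v z)) / G (v z)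
      * gradsq (\<lambda>z. W (v z)) z"
proof -
  have vpos: "v ` S \<subseteq> {0<..}" using v(4) J by blast
  have e1: "dt v z = m * v z powr (m - 1) * lap v z + m * (m - 1) * v z powr (m - 2) * gradsq v z"
    unfolding pde
  proof (rule lap_compose[OF v(1-3) vpos, where F = "\<lambda>r. r powr m"
        and G = "\<lambda>r. m * r powr (m - 1)" and g = "\<lambda>r. m * (m - 1) * r powr (m - 2)"])
    fix r :: real assume r: "r \<in> {0<..}"
    show "((\<lambda>r. r powr m) has_real_derivative m * r powr (m - 1)) (at r within {0<..})"
      using has_real_derivative_powr[of r m] r has_field_derivative_at_within by auto
    have "((\<lambda>r. m * r powr (m - 1)) has_real_derivative m * ((m - 1) * r powr (m - 1 - 1))) (at r)"
      using r by (intro DERIV_cmult has_real_derivative_powr) auto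
    then show "((\<lambda>r. m * r powr (m - 1)) has_real_derivative m * (m - 1) * r powr (m - 2))
        (at r within {0<..})"
      by (simp add: has_field_derivative_at_within mult.assoc)
  qed (rule smooth_on_powr_const)
  have e2: "dt (\<lambda>z. W (v z)) z = G (v z) * dt v z"
    by (rule dd_compose_on[OF v W])
  have e3: "lap (\<lambda>z. W (v z)) z = G (v z) * lap v z + g (v z) * gradsq v z"
    by (rule lap_compose[OF v W G])
  have e4: "gradsq (\<lambda>z. W (v z)) z = (G (v z))\<^sup>2 * gradsq v z"
    by (rule gradsq_compose[OF v W])
  show ?thesis
    unfolding e2 e3 e4 e1 using nz by (simp add: field_simps power2_eq_square)
qed

text \<open>Positivity far out makes the set of nonpositive values compact, so it contains a point
  of earliest time. There F is zero, and it is nonnegative at that time and before.\<close>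

lemma first_touching:
  fixes F :: "real \<times> 'a::euclidean_space \<Rightarrow> real"
  assumes cont: "continuous_on ({0..T} \<times> UNIV) F"
    and init: "\<And>y. F (0, y) > 0"
    and far: "\<And>t y. 0 \<le> t \<Longrightarrow> t \<le> T \<Longrightarrow> norm y > R \<Longrightarrow> F (t, y) > 0"
    and touch: "\<And>t y. 0 < t \<Longrightarrow> t \<le> T \<Longrightarrow> F (t, y) = 0 \<Longrightarrow> (\<And>y'. F (t, y') \<ge> 0)
      \<Longrightarrow> (\<And>s. 0 < s \<Longrightarrow> s < t \<Longrightarrow> F (s, y) \<ge> 0) \<Longrightarrow> False"
    and t: "0 \<le> t" "t \<le> T"
  shows "F (t, y) > 0"
proof (rule ccontr)
  assume neg: "\<not> F (t, y) > 0"
  define C where "C = {0..T} \<times> (cball 0 R :: 'a set)"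
  define Q where "Q = {z \<in> C. F z \<le> 0}"
  have C: "compact C" unfolding C_def by (intro compact_Times) auto
  have "continuous_on C F" using cont by (rule continuous_on_subset) (auto simp: C_def)
  then have "closed Q"
    unfolding Q_def using compact_imp_closed[OF C] by (intro continuous_closed_preimage_constant
        continuous_on_closed_Collect_le[where g = "\<lambda>_. 0"] continuous_on_const) auto
  then have "compact Q"
    using C by (metis (no_types, lifting) Q_def compact_Int_closed inf.absorb_iff2 mem_Collect_eq subsetI)
  moreover have "(t, y) \<in> Q"
    using neg far[of t y] t by (force simp: Q_def C_def not_less)
  ultimately obtain z1 where z1: "z1 \<in> Q" "\<And>z. z \<in> Q \<Longrightarrow> fst z1 \<le> fst z"
    using continuous_attains_inf[of Q fst] continuous_on_fst[OF continuous_on_id] by blast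
  obtain t1 y1 where eq: "z1 = (t1, y1)" by (cases z1)
  have t1: "0 \<le> t1" "t1 \<le> T" "F (t1, y1) \<le> 0" using z1(1) by (auto simp: eq Q_def C_def)
  then have "t1 \<noteq> 0" using init[of y1] by auto
  with t1 have t1pos: "t1 > 0" by simp
  have before: "F (s, y') > 0" if "0 \<le> s" "s < t1" for s y'
  proof (rule ccontr)
    assume "\<not> F (s, y') > 0"
    moreover from this have "(s, y') \<in> C"
      using far[of s y'] that t1 by (force simp: C_def not_less)
    ultimately have "(s, y') \<in> Q" by (simp add: Q_def)
    then show False using z1(2)[of "(s, y')"] that by (simp add: eq)
  qed
  \<comment> \<open>Values at the contact time are limits of the positive values at earlier
    times.\<close>
  have at: "F (t1, y') \<ge> 0" for y'
  proof -
    have cl: "closure {0<..<t1} = {0..t1}" using t1pos by (simp add: closure_greaterThanLessThan)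
    have "continuous_on {0..t1} (\<lambda>s. F (s, y'))"
      using t1 by (intro continuous_on_compose2[OF cont] continuous_intros) auto
    then show ?thesis
      using continuous_ge_on_closure[of "{0<..<t1}" "\<lambda>s. F (s, y')" t1 0] before t1pos
      unfolding cl by (auto simp: less_imp_le)
  qed
  show False
    using touch[OF t1pos t1(2), of y1] at before t1 by (force simp: antisym less_imp_le)
qed

text \<open>At the contact F has a spatial minimum, and it has come down from nonnegative values in
  time. The gradient of f therefore equals that of - \<epsilon> |y|^2; its exact size is what the
  lower bound exploits.\<close>

lemma touching_derivs:
  fixes f :: "real \<times> (real^'n) \<Rightarrow> real" and \<epsilon> \<beta> c :: real
  defines "F \<equiv> \<lambda>(s, y). f (s, y) + \<epsilon> * (norm y)\<^sup>2 + \<beta> * s - c"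
  assumes f: "smooth_on ({0<..} \<times> UNIV) f" and t: "t > 0"
    and F0: "F (t, y) = 0" and space: "\<And>y'. F (t, y') \<ge> 0"
    and time: "\<And>s. 0 < s \<Longrightarrow> s < t \<Longrightarrow> F (s, y) \<ge> 0"
  shows "dt f (t, y) \<le> - \<beta>" "lap f (t, y) \<ge> - 2 * real CARD('n) * \<epsilon>"
    "gradsq f (t, y) = 4 * \<epsilon>\<^sup>2 * (norm y)\<^sup>2"
proof -
  let ?S = "{0<..} \<times> UNIV :: (real \<times> (real^'n)) set"
  have S: "open ?S" by (intro open_Times) auto
  have "((\<lambda>s. f ((0, y) + s *\<^sub>R (1, 0))) has_real_derivative dt f ((0, y) + t *\<^sub>R (1, 0))) (at t)"
    using t by (intro dd_line[OF f S]) auto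
  then have "((\<lambda>s. - f (s, y) - \<beta> * s) has_real_derivative - dt f (t, y) - \<beta>) (at t)"
    by (auto intro!: derivative_eq_intros)
  then have "- dt f (t, y) - \<beta> \<ge> 0"
    by (rule left_max_deriv_nonneg[where a = 0]) (use t F0 time in \<open>force simp: F_def\<close>)+
  then show "dt f (t, y) \<le> - \<beta>" by simp
  have dxx: "dx i f (t, y) = - 2 * \<epsilon> * y $ i" "dx i (dx i f) (t, y) \<ge> - 2 * \<epsilon>" for i
  proof -
    define L where "L r = (t, y) + r *\<^sub>R (0, axis i 1)" for r
    have L: "L r \<in> ?S" "L r = (t, y + r *\<^sub>R axis i 1)" for r using t by (auto simp: L_def)
    have d1: "((\<lambda>r. f (L r)) has_real_derivative dx i f (L r)) (at r)" for r
      unfolding L_def using L(1) by (intro dd_line[OF f S]) (simp add: L_def)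
    have d2: "((\<lambda>r. dx i f (L r)) has_real_derivative dx i (dx i f) (L r)) (at r)" for r
      unfolding L_def using L(1) by (intro dd_line[OF smooth_on_dd[OF f S] S]) (simp add: L_def)
    define \<phi> where "\<phi> r = - f (L r) - \<epsilon> * ((norm y)\<^sup>2 + 2 * r * y $ i + r\<^sup>2)" for r
    define \<psi> where "\<psi> r = - dx i f (L r) - \<epsilon> * (2 * y $ i + 2 * r)" for r
    have max: "\<phi> r \<le> \<phi> 0" for r
      using F0 space[of "y + r *\<^sub>R axis i 1"] unfolding norm_add_axis_power2 F_def
      by (simp add: \<phi>_def L(2) norm_add_axis_power2)
    have "(\<phi> has_real_derivative \<psi> r) (at r)" for r
      unfolding \<phi>_def \<psi>_def by (auto intro!: derivative_eq_intros d1)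
    moreover have "(\<psi> has_real_derivative - dx i (dx i f) (L 0) - 2 * \<epsilon>) (at 0)"
      unfolding \<psi>_def by (auto intro!: derivative_eq_intros d2)
    ultimately have "\<psi> 0 = 0" "- dx i (dx i f) (L 0) - 2 * \<epsilon> \<le> 0"
      using local_max_derivs[of 1 \<phi> \<psi> "- dx i (dx i f) (L 0) - 2 * \<epsilon>"] max by auto
    then show "dx i f (t, y) = - 2 * \<epsilon> * y $ i" "dx i (dx i f) (t, y) \<ge> - 2 * \<epsilon>"
      by (auto simp: \<psi>_def L(2))
  qed
  have "(\<Sum>i\<in>(UNIV :: 'n set). - 2 * \<epsilon>) \<le> lap f (t, y)"
    unfolding lap_def by (intro sum_mono dxx)
  then show "lap f (t, y) \<ge> - 2 * real CARD('n) * \<epsilon>" by simp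
  have "gradsq f (t, y) = (\<Sum>i\<in>UNIV. 4 * \<epsilon>\<^sup>2 * (y $ i)\<^sup>2)"
    unfolding gradsq_def dxx by (intro sum.cong) (auto simp: power2_eq_square)
  then show "gradsq f (t, y) = 4 * \<epsilon>\<^sup>2 * (norm y)\<^sup>2"
    by (simp only: sum_distrib_left[symmetric] sum_power2_vec)
qed

text \<open>The barrier is \<open>c - \<epsilon> |y|\<^sup>2 - \<epsilon> K t\<close>; the premise \<open>contra\<close> excludes a first contact with it.\<close>

lemma barrier_min_principle:
  fixes f :: "real \<times> (real^'n) \<Rightarrow> real"
  assumes f: "smooth_on ({0<..} \<times> UNIV) f" and cont: "continuous_on ({0..T} \<times> UNIV) f"
    and below: "\<And>t y. 0 \<le> t \<Longrightarrow> t \<le> T \<Longrightarrow> f (t, y) \<ge> M"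
    and init: "\<And>y. f (0, y) > c" and K: "K \<ge> 0" and e0: "\<epsilon>0 > 0"
    and contra: "\<And>\<epsilon> t y. 0 < \<epsilon> \<Longrightarrow> \<epsilon> < \<epsilon>0 \<Longrightarrow> 0 < t \<Longrightarrow> t \<le> T
      \<Longrightarrow> f (t, y) + \<epsilon> * (norm y)\<^sup>2 + \<epsilon> * K * t = c \<Longrightarrow> dt f (t, y) \<le> - (\<epsilon> * K)
      \<Longrightarrow> lap f (t, y) \<ge> - 2 * real CARD('n) * \<epsilon> \<Longrightarrow> gradsq f (t, y) = 4 * \<epsilon>\<^sup>2 * (norm y)\<^sup>2 \<Longrightarrow> False"
    and t: "0 \<le> t" "t \<le> T"
  shows "f (t, y) \<ge> c"
proof -
  have pos: "f (t, y) + \<epsilon> * ((norm y)\<^sup>2 + K * t) > c" if \<epsilon>: "0 < \<epsilon>" "\<epsilon> < \<epsilon>0" for \<epsilon>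
  proof -
    define F where "F = (\<lambda>(s, y). f (s, y) + \<epsilon> * (norm y)\<^sup>2 + (\<epsilon> * K) * s - c)"
    \<comment> \<open>Beyond this radius the quadratic term alone outweighs the gap between c and
      the a priori bound M.\<close>
    define R where "R = sqrt (\<bar>c - M\<bar> / \<epsilon>)"
    have "F (t, y) > 0"
    proof (rule first_touching[where T = T and R = R])
      show "continuous_on ({0..T} \<times> UNIV) F"
        using cont unfolding F_def case_prod_unfold
        by (intro continuous_intros) auto
      show "F (0, y) > 0" for y
      proof -
        have "0 \<le> \<epsilon> * (norm y)\<^sup>2" using \<epsilon> by simp
        then show ?thesis using init[of y] by (simp add: F_def)
      qed
      show "F (t, y) > 0" if ty: "0 \<le> t" "t \<le> T" "norm y > R" for t y
      proof -
        have "R\<^sup>2 < (norm y)\<^sup>2" using ty(3) \<epsilon> by (intro power_strict_mono) (auto simp: R_def)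
        then have "\<bar>c - M\<bar> < \<epsilon> * (norm y)\<^sup>2" using \<epsilon> by (simp add: R_def field_simps)
        moreover have "0 \<le> \<epsilon> * K * t" using \<epsilon> K ty by simp
        ultimately show ?thesis using below[OF ty(1,2), of y] by (simp add: F_def)
      qed
      fix t y assume ty: "0 < t" "t \<le> T" "F (t, y) = 0" "\<And>y'. F (t, y') \<ge> 0"
        "\<And>s. 0 < s \<Longrightarrow> s < t \<Longrightarrow> F (s, y) \<ge> 0"
      show False
        using touching_derivs[OF f ty(1), of \<epsilon> "\<epsilon> * K" c y] ty(3-5) contra[OF \<epsilon> ty(1,2), of y]
        unfolding F_def[symmetric] by (simp add: F_def)
    qed (use t in auto)
    then show ?thesis by (simp add: F_def algebra_simps)
  qed
  have "c \<le> f (t, y) + 0 * ((norm y)\<^sup>2 + K * t)"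
  proof (rule tendsto_lowerbound)
    show "((\<lambda>\<epsilon>. f (t, y) + \<epsilon> * ((norm y)\<^sup>2 + K * t)) \<longlongrightarrow> f (t, y) + 0 * ((norm y)\<^sup>2 + K * t)) (at_right 0)"
      by (intro tendsto_intros)
    have "eventually (\<lambda>\<epsilon>. 0 < \<epsilon> \<and> \<epsilon> < \<epsilon>0) (at_right 0)"
      using eventually_at_right_real[OF e0] by simp
    then show "eventually (\<lambda>\<epsilon>. c \<le> f (t, y) + \<epsilon> * ((norm y)\<^sup>2 + K * t)) (at_right 0)"
      by eventually_elim (use pos in \<open>auto intro: less_imp_le\<close>)
  qed simp
  then show ?thesis by simp
qed

section \<open>Comparison principles for positive solutions\<close>

lemma powr_le_interval:
  fixes r :: real
  assumes "0 < a" "a \<le> r" "r \<le> b"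
  shows "r powr e \<le> a powr e + b powr e"
proof (cases "e \<ge> 0")
  case True
  then have "r powr e \<le> b powr e" using assms by (intro powr_mono2) auto
  then show ?thesis by (simp add: add_increasing)
next
  case False
  then have "r powr e \<le> a powr e" using assms by (intro powr_mono2') auto
  then show ?thesis by (simp add: add_increasing2)
qed

locale porous_medium_solution =
  fixes v :: "real \<times> (real^'n) \<Rightarrow> real" and m :: real
  assumes m: "m > 0"
    and smooth: "smooth_on ({0<..} \<times> UNIV) v"
    and cont: "continuous_on ({0..} \<times> UNIV) v"
    and pos: "\<And>t y. t \<ge> 0 \<Longrightarrow> v (t, y) > 0"
    and pde: "\<And>z. z \<in> {0<..} \<times> UNIV \<Longrightarrow> dt v z = lap (\<lambda>z. v z powr m) z"
begin

lemma cont_powr: "continuous_on ({0..T} \<times> UNIV) (\<lambda>z. v z powr a)"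
  by (intro continuous_intros continuous_on_subset[OF cont]) (use pos in \<open>auto simp: less_le\<close>)

text \<open>With q = m / (n + 1) one has m - q = q n, so w = v^q satisfies w_t = m w^e (lap w + n
  |grad w|^2 / w). At a first contact with the barrier either w is comparable to c and the
  diffusivity is bounded, or w is small. In the latter case the contact is far out, the gradient
  term exceeds the negative part of the Laplacian, and the sign of w_t is contradictory whatever the
  size of w^e.\<close>

lemma lower_bound:
  assumes \<delta>: "\<delta> > 0" "\<And>y. v (0, y) \<ge> \<delta>" and t: "t \<ge> 0"
  shows "v (t, y) \<ge> \<delta>"
proof -
  define n where "n = real CARD('n)"
  define q where "q = m / (n + 1)"
  define e where "e = (m - 1) / q"
  define w where "w z = v z powr q" for z
  have n: "n \<ge> 1" by (simp add: n_def Suc_le_eq)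
  have q: "q > 0" using m n by (simp add: q_def)
  have S: "open ({0<..} \<times> UNIV :: (real \<times> (real^'n)) set)" by (intro open_Times) auto
  have w: "smooth_on ({0<..} \<times> UNIV) w"
    unfolding w_def using smooth pos by (intro smooth_on_powr) auto
  have eqn: "dt w z = m * w z powr e * (lap w z + n * gradsq w z / w z)"
    if z: "z \<in> {0<..} \<times> UNIV" for z
  proof -
    define r where "r = v z"
    have r: "r > 0" using pos z by (cases z) (auto simp: r_def)
    have "dt w z = m * v z powr (m - 1) * lap w z
        + (m * (m - 1) * v z powr (m - 2)
            - m * v z powr (m - 1) * (q * (q - 1) * v z powr (q - 2)) / (q * v z powr (q - 1)))
          / (q * v z powr (q - 1)) * gradsq w z"
      unfolding w_def
    proof (rule transformed_pde[OF smooth S z, where J = "{0<..}" and W = "\<lambda>r. r powr q"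
          and G = "\<lambda>r. q * r powr (q - 1)" and g = "\<lambda>r. q * (q - 1) * r powr (q - 2)"])
      fix r :: real assume r: "r \<in> {0<..}"
      show "((\<lambda>r. r powr q) has_real_derivative q * r powr (q - 1)) (at r within {0<..})"
        using has_real_derivative_powr[of r q] r has_field_derivative_at_within by auto
      have "((\<lambda>r. q * r powr (q - 1)) has_real_derivative q * ((q - 1) * r powr (q - 1 - 1))) (at r)"
        using r by (intro DERIV_cmult has_real_derivative_powr) auto
      then show "((\<lambda>r. q * r powr (q - 1)) has_real_derivative q * (q - 1) * r powr (q - 2))
          (at r within {0<..})"
        by (simp add: has_field_derivative_at_within mult.assoc)
    next
      show "q * v z powr (q - 1) \<noteq> 0" using q r by (simp add: r_def)
    qed (use pos pde z smooth_on_powr_const in auto)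
    also have "(m * (m - 1) * v z powr (m - 2)
            - m * v z powr (m - 1) * (q * (q - 1) * v z powr (q - 2)) / (q * v z powr (q - 1)))
          / (q * v z powr (q - 1)) = m * v z powr (m - 1) * n / w z"
    proof -
      define X Y where "X = r powr (m - 1)" and "Y = r powr (q - 1)"
      have XY: "r powr (m - 2) = X / r" "r powr (q - 2) = Y / r" "r powr q = Y * r"
        using r powr_diff[of r "m - 1" 1] powr_diff[of r "q - 1" 1] powr_add[of r "q - 1" 1]
        by (auto simp: X_def Y_def)
      have Y: "Y > 0" using r by (simp add: Y_def)
      have "(m * (m - 1) * (X / r) - m * X * (q * (q - 1) * (Y / r)) / (q * Y)) / (q * Y)
          = m * X * (m - q) / (q * (Y * r))"
        using Y r q by (simp add: field_simps)
      moreover have "m - q = q * n" using n by (simp add: q_def field_simps)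
      ultimately show ?thesis
        unfolding w_def r_def[symmetric] XY X_def[symmetric] Y_def[symmetric] using q by simp
    qed
    also have "v z powr (m - 1) = w z powr e"
      using q by (simp add: w_def e_def powr_powr)
    finally show ?thesis by (simp add: algebra_simps)
  qed
  \<comment> \<open>The factor \<theta> < 1 makes the initial inequality strict.\<close>
  have "\<theta> * \<delta> powr q \<le> w (t, y)" if \<theta>: "0 < \<theta>" "\<theta> < 1" for \<theta>
  proof -
    define c where "c = \<theta> * \<delta> powr q"
    have c: "c > 0" using \<delta> \<theta> by (simp add: c_def)
    define a where "a = m * ((c / 4) powr e + c powr e)"
    \<comment> \<open>a bounds the diffusivity for w between c / 4 and c, and 2 n \<epsilon> bounds
      the negative part of the Laplacian at a contact; the added 1 gives the contradiction.\<close>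
    define K where "K = 2 * n * a + 1"
    have a: "a > 0" unfolding a_def using m c by (intro mult_pos_pos add_pos_pos) auto
    have K: "K > 0" using a n by (simp add: K_def add_pos_pos)
    \<comment> \<open>Keeps the time part of the barrier below c / 4 up to time t; t + 1 avoids
      division by zero at t = 0.\<close>
    define \<epsilon>0 where "\<epsilon>0 = c / (4 * (K * (t + 1)))"
    have e0: "\<epsilon>0 > 0" using c K t by (simp add: \<epsilon>0_def)
    show ?thesis
      unfolding c_def[symmetric]
    proof (rule barrier_min_principle[OF w _ _ _ less_imp_le[OF K] e0, where T = t and M = 0])
      show "continuous_on ({0..t} \<times> UNIV) w" unfolding w_def by (rule cont_powr)
      show "w (s, y') \<ge> 0" for s y' by (simp add: w_def)
      show "w (0, y') > c" for y'
      proof -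
        have "c < \<delta> powr q" using \<delta> \<theta> by (simp add: c_def)
        also have "\<dots> \<le> w (0, y')" unfolding w_def using \<delta> q by (intro powr_mono2) auto
        finally show ?thesis .
      qed
    next
      fix \<epsilon> s y'
      assume \<epsilon>: "0 < \<epsilon>" "\<epsilon> < \<epsilon>0" and s: "0 < s" "s \<le> t"
        and eq: "w (s, y') + \<epsilon> * (norm y')\<^sup>2 + \<epsilon> * K * s = c"
        and dtw: "dt w (s, y') \<le> - (\<epsilon> * K)" and lapw: "lap w (s, y') \<ge> - 2 * real CARD('n) * \<epsilon>"
        and gr: "gradsq w (s, y') = 4 * \<epsilon>\<^sup>2 * (norm y')\<^sup>2"
      define r where "r = w (s, y')"
      have r: "r > 0" using pos[of s y'] s by (simp add: r_def w_def)
      have eKs: "\<epsilon> * K * s \<le> c / 4"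
      proof -
        have "\<epsilon> * K * s \<le> \<epsilon>0 * K * (t + 1)"
          using \<epsilon> K s by (intro mult_mono) auto
        also have "\<dots> = \<epsilon>0 * (K * (t + 1))" by simp
        also have "\<dots> = c / 4"
        proof -
          have "K * (t + 1) \<noteq> 0" using K t by simp
          then show ?thesis unfolding \<epsilon>0_def by (simp del: mult_eq_0_iff)
        qed
        finally show ?thesis .
      qed
      have rc: "r \<le> c" using eq \<epsilon> K s by (simp add: r_def add_nonneg_nonneg flip: eq)
      have dtr: "dt w (s, y') = m * r powr e * (lap w (s, y') + n * (4 * \<epsilon>\<^sup>2 * (norm y')\<^sup>2) / r)"
        using eqn[of "(s, y')"] s by (simp add: r_def gr)
      have ge: "- 2 * n * \<epsilon> \<le> lap w (s, y')" using lapw by (simp add: n_def)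
      have nn: "0 \<le> n * (4 * \<epsilon>\<^sup>2 * (norm y')\<^sup>2) / r" using n r by simp
      show False
      proof (cases "r \<ge> c / 4")
        case True
        have "m * r powr e \<le> a"
          unfolding a_def using powr_le_interval[of "c / 4" r c e] True rc c m by (intro mult_left_mono) auto
        then have "m * r powr e * (2 * n * \<epsilon>) \<le> a * (2 * n * \<epsilon>)"
          using n \<epsilon> by (intro mult_right_mono) auto
        moreover have "m * r powr e * (- 2 * n * \<epsilon>) \<le> dt w (s, y')"
          unfolding dtr using ge nn m by (intro mult_left_mono) auto
        moreover have "m * r powr e * (- 2 * n * \<epsilon>) = - (m * r powr e * (2 * n * \<epsilon>))" by simp
        moreover have "\<epsilon> * K = a * (2 * n * \<epsilon>) + \<epsilon>" by (simp add: K_def algebra_simps)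
        ultimately show False using dtw \<epsilon> by linarith
      next
        case False
        \<comment> \<open>Of the total c, both w and the time part take at most a quarter, so the
          spatial part takes at least half and exceeds 2 w. Hence n |grad w|^2 / w is at least 8 n
          \<epsilon>, against the loss 2 n \<epsilon>.\<close>
        then have "c / 2 \<le> \<epsilon> * (norm y')\<^sup>2" using eq eKs by (simp add: r_def)
        moreover have "2 * r < c / 2" using False by simp
        ultimately have "2 * r < \<epsilon> * (norm y')\<^sup>2" by linarith
        then have "(4 * n * \<epsilon>) * (2 * r) \<le> (4 * n * \<epsilon>) * (\<epsilon> * (norm y')\<^sup>2)"
          using n \<epsilon> by (intro mult_left_mono) auto
        then have "8 * n * \<epsilon> \<le> n * (4 * \<epsilon>\<^sup>2 * (norm y')\<^sup>2) / r"
          using r by (simp add: field_simps power2_eq_square)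
        moreover have "2 * n * \<epsilon> < 8 * n * \<epsilon>" using n \<epsilon> by simp
        ultimately have "0 < lap w (s, y') + n * (4 * \<epsilon>\<^sup>2 * (norm y')\<^sup>2) / r" using ge by linarith
        then have "0 < dt w (s, y')" unfolding dtr using m r by (intro mult_pos_pos) auto
        then show False using dtw \<epsilon> K mult_pos_pos[of \<epsilon> K] by linarith
      qed
    qed (use t in auto)
  qed
  then have "\<delta> powr q \<le> w (t, y)" by (rule field_le_mult_one_interval)
  then show ?thesis
    using powr_less_mono2[OF q, of "v (t, y)" \<delta>] pos[OF t, of y] unfolding w_def by fastforce
qed

text \<open>For - v^m the equation has no gradient term, so the Laplacian bound at a contact
  decides. The crude bounds \<delta> and b control the diffusivity, and b also controls the far
  field; the conclusion has the sharp initial bound M.\<close>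

lemma upper_bound:
  assumes \<delta>: "\<delta> > 0" "\<And>s y. 0 \<le> s \<Longrightarrow> s \<le> t \<Longrightarrow> \<delta> \<le> v (s, y)"
    and b: "\<And>s y. 0 \<le> s \<Longrightarrow> s \<le> t \<Longrightarrow> v (s, y) \<le> b"
    and M: "\<And>y. v (0, y) \<le> M" and t: "t \<ge> 0"
  shows "v (t, y) \<le> M"
proof -
  define n where "n = real CARD('n)"
  define f where "f z = - 1 * v z powr m" for z
  define a where "a = m * (\<delta> powr (m - 1) + b powr (m - 1))"
  define K where "K = 2 * n * a + 1"
  have n: "n \<ge> 1" by (simp add: n_def Suc_le_eq)
  have a: "a > 0" using m \<delta> by (simp add: a_def add_pos_nonneg)
  have K: "K > 0" using a n by (simp add: K_def add_pos_pos)
  have Mpos: "M > 0" using M[of undefined] pos[of 0 undefined] by simp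
  have S: "open ({0<..} \<times> UNIV :: (real \<times> (real^'n)) set)" by (intro open_Times) auto
  have f: "smooth_on ({0<..} \<times> UNIV) f"
    unfolding f_def using smooth pos by (intro smooth_on_mult smooth_on_const smooth_on_powr) auto
  have eqn: "dt f z = m * v z powr (m - 1) * lap f z" if z: "z \<in> {0<..} \<times> UNIV" for z
  proof -
    define r where "r = v z"
    have r: "r > 0" using pos z by (cases z) (auto simp: r_def)
    have "dt f z = m * v z powr (m - 1) * lap f z
        + (m * (m - 1) * v z powr (m - 2)
            - m * v z powr (m - 1) * (- m * (m - 1) * v z powr (m - 2)) / (- m * v z powr (m - 1)))
          / (- m * v z powr (m - 1)) * gradsq f z"
      unfolding f_def
    proof (rule transformed_pde[OF smooth S z, where J = "{0<..}" and W = "\<lambda>r. - 1 * r powr m"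
          and G = "\<lambda>r. - m * r powr (m - 1)" and g = "\<lambda>r. - m * (m - 1) * r powr (m - 2)"])
      fix r :: real assume r: "r \<in> {0<..}"
      have "((\<lambda>r. - 1 * r powr m) has_real_derivative - 1 * (m * r powr (m - 1))) (at r)"
        using r by (intro DERIV_cmult has_real_derivative_powr) auto
      then show "((\<lambda>r. - 1 * r powr m) has_real_derivative - m * r powr (m - 1)) (at r within {0<..})"
        by (simp add: has_field_derivative_at_within)
      have "((\<lambda>r. - m * r powr (m - 1)) has_real_derivative - m * ((m - 1) * r powr (m - 1 - 1))) (at r)"
        using r by (intro DERIV_cmult has_real_derivative_powr) auto
      then show "((\<lambda>r. - m * r powr (m - 1)) has_real_derivative - m * (m - 1) * r powr (m - 2))
          (at r within {0<..})"
        by (simp add: has_field_derivative_at_within mult.assoc)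
    next
      show "- m * v z powr (m - 1) \<noteq> 0" using m r by (simp add: r_def)
      show "smooth_on {0<..} (\<lambda>r. - m * r powr (m - 1))" by (rule smooth_on_powr_const)
    qed (use pos pde z smooth_on_powr_const in auto)
    then show ?thesis using m r by (simp add: r_def)
  qed
  \<comment> \<open>The margin \<eta> makes the initial inequality strict.\<close>
  have "- (M powr m) - \<eta> \<le> f (t, y)" if \<eta>: "0 < \<eta>" for \<eta>
  proof (rule barrier_min_principle[OF f _ _ _ less_imp_le[OF K] zero_less_one, where T = t and M = "- (b powr m)"])
    show "continuous_on ({0..t} \<times> UNIV) f"
      unfolding f_def by (intro continuous_intros cont_powr)
    show "- (b powr m) \<le> f (s, y')" if "0 \<le> s" "s \<le> t" for s y'
      using b[OF that, of y'] pos[OF that(1), of y'] m by (auto simp: f_def intro!: powr_mono2)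
    show "- (M powr m) - \<eta> < f (0, y')" for y'
    proof -
      have "v (0, y') powr m \<le> M powr m"
        using M[of y'] pos[of 0 y'] m by (intro powr_mono2) auto
      then show ?thesis using \<eta> by (simp add: f_def)
    qed
  next
    fix \<epsilon> s y'
    assume \<epsilon>: "0 < \<epsilon>" and s: "0 < s" "s \<le> t"
      and dtf: "dt f (s, y') \<le> - (\<epsilon> * K)" and lapf: "lap f (s, y') \<ge> - 2 * real CARD('n) * \<epsilon>"
    define r where "r = v (s, y')"
    have "m * r powr (m - 1) \<le> a"
      unfolding a_def r_def using \<delta>(2)[of s y'] b[of s y'] \<delta>(1) s m
      by (intro mult_left_mono powr_le_interval) auto
    then have "m * r powr (m - 1) * (2 * n * \<epsilon>) \<le> a * (2 * n * \<epsilon>)"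
      using n \<epsilon> by (intro mult_right_mono) auto
    moreover have "m * r powr (m - 1) * (- 2 * n * \<epsilon>) \<le> m * r powr (m - 1) * lap f (s, y')"
      using lapf m by (intro mult_left_mono) (auto simp: n_def)
    moreover have "dt f (s, y') = m * r powr (m - 1) * lap f (s, y')"
      using eqn[of "(s, y')"] s by (simp add: r_def)
    moreover have "m * r powr (m - 1) * (- 2 * n * \<epsilon>) = - (m * r powr (m - 1) * (2 * n * \<epsilon>))"
      by simp
    moreover have "\<epsilon> * K = a * (2 * n * \<epsilon>) + \<epsilon>" by (simp add: K_def algebra_simps)
    ultimately show False using dtf \<epsilon> by linarith
  qed (use t in auto)
  then have "- (M powr m) \<le> f (t, y)"
    by (metis add.commute diff_le_eq field_le_epsilon)
  then have "v (t, y) powr m \<le> M powr m" by (simp add: f_def)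
  then show ?thesis
    using powr_less_mono2[OF m, of M "v (t, y)"] Mpos by fastforce
qed

end

section \<open>The estimate for the porous medium equation\<close>

text \<open>The form with \<open>c / r\<close> keeps the original power as a factor, so products of
  powers are differentiated logarithmically.\<close>

lemma DERIV_powr_const:
  "r > 0 \<Longrightarrow> ((\<lambda>r. r powr c) has_real_derivative r powr c * (c / r)) (at r)" for r :: real
  using has_real_derivative_powr[of r c] by (simp add: powr_diff mult.commute)

lemma DERIV_diff_powr:
  fixes r :: real
  assumes "r > 0" "r powr h < N"
  shows "((\<lambda>r. (N - r powr h) powr c) has_real_derivative
    (N - r powr h) powr c * (- c * h * r powr h / (r * (N - r powr h)))) (at r)"
proof -
  have "((\<lambda>r. N - r powr h) has_real_derivative 0 - r powr h * (h / r)) (at r)"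
    by (intro DERIV_diff DERIV_const DERIV_powr_const assms)
  from DERIV_chain2[OF DERIV_powr_const this]
  show ?thesis using assms by (simp add: mult_ac)
qed

lemma smooth_on_id_powr: "S \<subseteq> {0<..} \<Longrightarrow> smooth_on S (\<lambda>r::real. r powr a)"
  using smooth_on_powr_const[of 1 a] smooth_on_subset by auto

text \<open>Here \<open>\<xi> = 1 / \<rho>\<close>.  The factor \<open>n - 1\<close> of the trace inequality is what produces exactly \<open>D\<close>.\<close>

lemma gradsq_coefficient_identity:
  fixes m h n \<xi> :: real
  defines "E \<equiv> (m + 1 - h) / 2 - h / 2 * \<xi>"
  shows "2 * ((m - 2) * E - h\<^sup>2 / 2 * \<xi> * (1 + \<xi>) - E * ((m + h - 3) / 2 + h / 2 * \<xi>))
      + (n - 1) * (m - 1)\<^sup>2 / 2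
    = - (1 / 2) * (- (h\<^sup>2 - 2 * m * h + n * (m - 1)\<^sup>2 + 2 * (m - 1)) + 2 * m * h * \<xi> + h\<^sup>2 * \<xi>\<^sup>2)"
  unfolding E_def by (simp add: field_simps power2_eq_square)

text \<open>G is the square root of the weight r^(m+h-3) / (N - r^h), G1 its reciprocal and L = r G'
  / G. For w = W(v) with W' = G the gradient coefficient is b, with E = m - 1 - L. Derivatives with
  respect to w arise from those with respect to v by multiplication with G1.\<close>

lemma weighted_gradient_estimate:
  fixes v :: "real \<times> (real^'n) \<Rightarrow> real" and m h T N \<delta> B \<kappa> :: real
  defines "S \<equiv> {0<..<T} \<times> (UNIV :: (real^'n) set)" and "D \<equiv> h_prod CARD('n) m h"
  assumes m: "m > 0" and v: "smooth_on S v"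
    and pde: "\<And>z. z \<in> S \<Longrightarrow> dt v z = lap (\<lambda>z. v z powr m) z"
    and vJ: "\<And>z. z \<in> S \<Longrightarrow> v z \<in> {\<delta>..B}" and \<delta>: "\<delta> > 0"
    and N: "\<And>r. r \<in> {\<delta>..B} \<Longrightarrow> r powr h < N"
    and \<kappa>: "\<And>r. r \<in> {\<delta>..B} \<Longrightarrow>
      \<kappa> \<le> m / 2 * (- D * (N / r powr h - 1) + 2 * m * h + h\<^sup>2 / (N / r powr h - 1))" "\<kappa> > 0"
    and t: "0 < t" "t < T"
  shows "\<kappa> * t * (v (t, x) powr (m + h - 3) * gradsq v (t, x)) \<le> N - v (t, x) powr h"
proof -
  define J where "J = {\<delta>..B}"
  define \<alpha> where "\<alpha> = (m + h - 3) / 2"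
  define X where "X r = r powr h" for r
  define G where "G r = r powr \<alpha> * (N - X r) powr (- 1 / 2)" for r
  define G1 where "G1 r = r powr (- \<alpha>) * (N - X r) powr (1 / 2)" for r
  \<comment> \<open>The reciprocal of N - X is written as a power so that the smoothness of powers
    covers it.\<close>
  define L where "L r = (m + h - 3) / 2 + h / 2 * (X r * (N - X r) powr (- 1))" for r
  define E where "E r = (m + 1 - h) / 2 + (- h / 2) * (X r * (N - X r) powr (- 1))" for r
  define b where "b r = m * r powr (m - 2) * (E r * G1 r)" for r
  define b' where "b' r = m * r powr (m - 2) * G1 r / r
      * ((m - 2) * E r - h\<^sup>2 / 2 * (X r / (N - X r)) * (1 + X r / (N - X r)) - E r * L r)" for r
  have S: "open S" unfolding S_def by (intro open_Times) auto
  have r: "r > 0" "X r > 0" "N - X r > 0" if "r \<in> J" for r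
    using that \<delta> N[of r] by (auto simp: J_def X_def)
  have J0: "J \<subseteq> {0<..}" using r by auto
  have vS: "v ` S \<subseteq> J" using vJ by (auto simp: J_def)
  have smX: "smooth_on J (\<lambda>r. r powr a)" "smooth_on J (\<lambda>r. (N - X r) powr a)" for a
  proof -
    show *: "smooth_on J (\<lambda>r. r powr a)" for a by (rule smooth_on_id_powr[OF J0])
    have "smooth_on J (\<lambda>r. N + (- 1) * X r)"
      unfolding X_def using * by (intro smooth_on_add smooth_on_mult smooth_on_const)
    then show "smooth_on J (\<lambda>r. (N - X r) powr a)" using r by (intro smooth_on_powr) auto
  qed
  have smG: "smooth_on J G" "smooth_on J G1"
    unfolding G_def[abs_def] G1_def[abs_def] by (intro smooth_on_mult smX)+
  have smb: "smooth_on J b"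
    unfolding b_def[abs_def] E_def[abs_def] X_def[abs_def]
    by (intro smooth_on_mult smooth_on_add smooth_on_const smX smX[unfolded X_def] smG)
  have pinv: "(N - X r) powr (- 1) = 1 / (N - X r)" if "r \<in> J" for r
    using r[OF that] by (simp add: powr_minus_divide)
  have GG1: "G r * G1 r = 1" if "r \<in> J" for r
    using r[OF that] by (simp add: G_def G1_def powr_minus field_simps flip: powr_add)
  have G0: "G r > 0" "G1 r > 0" if "r \<in> J" for r using r[OF that] by (auto simp: G_def G1_def)
  have dG: "(G has_real_derivative G r * (L r / r)) (at r)" if "r \<in> J" for r
  proof -
    have "(G has_real_derivative r powr \<alpha> * (\<alpha> / r) * (N - X r) powr (- 1 / 2)
        + (N - X r) powr (- 1 / 2) * (- (- 1 / 2) * h * X r / (r * (N - X r))) * r powr \<alpha>) (at r)"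
      unfolding G_def X_def
      by (rule DERIV_mult[OF DERIV_powr_const DERIV_diff_powr]) (use r[OF that] in \<open>auto simp: X_def\<close>)
    moreover have "r powr \<alpha> * (\<alpha> / r) * (N - X r) powr (- 1 / 2)
        + (N - X r) powr (- 1 / 2) * (- (- 1 / 2) * h * X r / (r * (N - X r))) * r powr \<alpha>
        = G r * (L r / r)"
      using r[OF that] by (simp add: G_def L_def \<alpha>_def pinv[OF that] field_simps)
    ultimately show ?thesis by simp
  qed
  have dG1: "(G1 has_real_derivative - (G1 r * (L r / r))) (at r)" if "r \<in> J" for r
  proof -
    have "(G1 has_real_derivative r powr (- \<alpha>) * (- \<alpha> / r) * (N - X r) powr (1 / 2)
        + (N - X r) powr (1 / 2) * (- (1 / 2) * h * X r / (r * (N - X r))) * r powr (- \<alpha>)) (at r)"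
      unfolding G1_def X_def
      by (rule DERIV_mult[OF DERIV_powr_const DERIV_diff_powr]) (use r[OF that] in \<open>auto simp: X_def\<close>)
    moreover have "r powr (- \<alpha>) * (- \<alpha> / r) * (N - X r) powr (1 / 2)
        + (N - X r) powr (1 / 2) * (- (1 / 2) * h * X r / (r * (N - X r))) * r powr (- \<alpha>)
        = - (G1 r * (L r / r))"
      using r[OF that] by (simp add: G1_def L_def \<alpha>_def pinv[OF that] field_simps)
    ultimately show ?thesis by simp
  qed
  have dE: "(E has_real_derivative - (h\<^sup>2 / 2 * (X r / (N - X r)) * (1 + X r / (N - X r)) / r)) (at r)"
    if "r \<in> J" for r
  proof -
    have "((\<lambda>r. X r * (N - X r) powr (- 1)) has_real_derivative
        X r * (h / r) * (N - X r) powr (- 1)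
        + (N - X r) powr (- 1) * (- (- 1) * h * X r / (r * (N - X r))) * X r) (at r)"
      unfolding X_def
      by (rule DERIV_mult[OF DERIV_powr_const DERIV_diff_powr]) (use r[OF that] in \<open>auto simp: X_def\<close>)
    then have "(E has_real_derivative 0 + (- h / 2) * (X r * (h / r) * (N - X r) powr (- 1)
        + (N - X r) powr (- 1) * (- (- 1) * h * X r / (r * (N - X r))) * X r)) (at r)"
      unfolding E_def by (intro DERIV_add DERIV_const DERIV_cmult)
    moreover have "0 + (- h / 2) * (X r * (h / r) * (N - X r) powr (- 1)
        + (N - X r) powr (- 1) * (- (- 1) * h * X r / (r * (N - X r))) * X r)
        = - (h\<^sup>2 / 2 * (X r / (N - X r)) * (1 + X r / (N - X r)) / r)"
    proof -
      define Y where "Y = N - X r"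
      have "Y > 0" using r[OF that] by (simp add: Y_def)
      then show ?thesis
        unfolding pinv[OF that] Y_def[symmetric] using r(1)[OF that]
        by (simp add: field_simps power2_eq_square)
    qed
    ultimately show ?thesis by simp
  qed
  have db: "(b has_real_derivative b' r) (at r)" if "r \<in> J" for r
  proof -
    have "(b has_real_derivative m * (r powr (m - 2) * ((m - 2) / r)) * (E r * G1 r)
        + (- (h\<^sup>2 / 2 * (X r / (N - X r)) * (1 + X r / (N - X r)) / r) * G1 r
            + - (G1 r * (L r / r)) * E r) * (m * r powr (m - 2))) (at r)"
      unfolding b_def
      by (intro DERIV_mult DERIV_cmult DERIV_powr_const dE dG1 that r)
    moreover have "m * (r powr (m - 2) * ((m - 2) / r)) * (E r * G1 r)
        + (- (h\<^sup>2 / 2 * (X r / (N - X r)) * (1 + X r / (N - X r)) / r) * G1 r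
            + - (G1 r * (L r / r)) * E r) * (m * r powr (m - 2)) = b' r"
      using r(1)[OF that] by (simp add: b'_def algebra_simps add_divide_distrib diff_divide_distrib)
    ultimately show ?thesis by simp
  qed
  \<comment> \<open>The primitive is taken on the compact interval J only, which is why all chain
    rules use derivatives within J.\<close>
  obtain W where "\<And>r. r \<in> J \<Longrightarrow> (W has_vector_derivative G r) (at r within J)"
    unfolding J_def
    using antiderivative_continuous[OF smooth_on_continuous_on[OF smG(1)[unfolded J_def]]] by metis
  then have W: "(W has_real_derivative G r) (at r within J)" if "r \<in> J" for r
    using that by (simp add: has_real_derivative_iff_has_vector_derivative)
  define w where "w z = W (v z)" for z
  have smw: "smooth_on S w"
    unfolding w_def
    by (rule smooth_on_compose[OF smooth_on_antiderivative[OF smG(1) W] v vS])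
  have powers: "r powr (m - 1) = r powr (m - 2) * r" if "r \<in> J" for r
    using r(1)[OF that] powr_add[of r "m - 2" 1] by simp
  \<comment> \<open>The exponent of the weight cancels every power of r except X; this quotient is
    \<rho>.\<close>
  have ratio: "r powr (m - 2) * (G1 r)\<^sup>2 / r = (N - X r) / X r" if "r \<in> J" for r
  proof -
    have g2: "(G1 r)\<^sup>2 = r powr (- (m + h - 3)) * (N - X r)"
    proof -
      have "(r powr (- \<alpha>))\<^sup>2 = r powr (- (m + h - 3))"
        unfolding power2_eq_square powr_add[symmetric] by (simp add: \<alpha>_def)
      moreover have "((N - X r) powr (1 / 2))\<^sup>2 = N - X r"
        unfolding power2_eq_square powr_add[symmetric] using r[OF that] by simp
      ultimately show ?thesis by (simp only: G1_def power_mult_distrib)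
    qed
    have pr: "r powr (m - 2) * r powr (- (m + h - 3)) / r = 1 / X r"
    proof -
      have "r powr (m - 2) * r powr (- (m + h - 3)) / r = r powr (m - 2 + (- (m + h - 3)) - 1)"
        using r(1)[OF that] by (simp only: powr_add powr_diff powr_one)
      also have "\<dots> = 1 / X r" by (simp add: X_def powr_minus_divide)
      finally show ?thesis .
    qed
    have "r powr (m - 2) * (G1 r)\<^sup>2 / r
        = (r powr (m - 2) * r powr (- (m + h - 3)) / r) * (N - X r)"
      unfolding g2 by simp
    then show ?thesis unfolding pr by simp
  qed
  have main: "2 * (b' r * G1 r) + (real CARD('n) - 1) * (m * (m - 1) * r powr (m - 2) * G1 r)\<^sup>2
      / (2 * (m * r powr (m - 1))) \<le> - \<kappa>" if rJ: "r \<in> J" for r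
  proof -
    define \<xi> where "\<xi> = X r / (N - X r)"
    define \<rho> where "\<rho> = N / X r - 1"
    define Z where "Z = r powr (m - 2)"
    have Z: "Z > 0" using r(1)[OF rJ] by (simp add: Z_def)
    have \<xi>: "\<xi> > 0" and \<rho>: "\<rho> > 0" "\<rho> = (N - X r) / X r" "1 / \<rho> = \<xi>"
      using r[OF rJ] by (auto simp: \<xi>_def \<rho>_def field_simps)
    have rat: "Z * (G1 r)\<^sup>2 / r = \<rho>" unfolding \<rho>(2) Z_def by (rule ratio[OF rJ])
    have EL: "E r = (m + 1 - h) / 2 - h / 2 * \<xi>" "L r = (m + h - 3) / 2 + h / 2 * \<xi>"
      unfolding E_def L_def \<xi>_def pinv[OF rJ] by simp_all
    have "2 * (b' r * G1 r) + (real CARD('n) - 1) * (m * (m - 1) * r powr (m - 2) * G1 r)\<^sup>2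
        / (2 * (m * r powr (m - 1)))
        = m * (Z * (G1 r)\<^sup>2 / r) * (2 * ((m - 2) * E r - h\<^sup>2 / 2 * \<xi> * (1 + \<xi>) - E r * L r)
          + (real CARD('n) - 1) * (m - 1)\<^sup>2 / 2)"
      unfolding b'_def powers[OF rJ] Z_def[symmetric] \<xi>_def[symmetric]
      using r(1)[OF rJ] Z m by (simp add: field_simps power2_eq_square)
    also have "\<dots> = m * \<rho> * (- (1 / 2) * (- D + 2 * m * h * \<xi> + h\<^sup>2 * \<xi>\<^sup>2))"
      unfolding rat EL gradsq_coefficient_identity by (simp add: D_def h_prod_def)
    also have "\<dots> = - (m / 2 * (- D * \<rho> + 2 * m * h + h\<^sup>2 / \<rho>))"
      unfolding \<rho>(3)[symmetric] using \<rho>(1) by (simp add: field_simps power2_eq_square)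
    also have "\<dots> \<le> - \<kappa>"
      using \<kappa>(1)[of r] rJ by (simp add: J_def \<rho>_def X_def)
    finally show ?thesis .
  qed
  define A where "A z = m * v z powr (m - 1)" for z
  define A' where "A' z = m * (m - 1) * v z powr (m - 2) * G1 (v z)" for z
  have zJ: "v z \<in> J" if "z \<in> S" for z using vJ[OF that] by (simp add: J_def)
  have dw: "dx k w z = G (v z) * dx k v z" if "z \<in> S" for z k
    unfolding w_def by (rule dd_compose_on[OF v S that vS W])
  have "compact J" by (simp add: J_def)
  \<comment> \<open>The constant K of \<open>gradient_estimate\<close> is absent from its
    conclusion, so bounds from compactness of J suffice.\<close>
  then have bounded: "\<exists>K. \<forall>r\<in>J. \<bar>f r\<bar> \<le> K" if "continuous_on J f" for f :: "real \<Rightarrow> real"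
    using compact_imp_bounded[OF compact_continuous_image[OF that]]
    by (auto simp: bounded_iff)
  obtain K1 where K1: "\<And>r. r \<in> J \<Longrightarrow> \<bar>m * r powr (m - 1)\<bar> \<le> K1"
    using bounded[OF smooth_on_continuous_on[OF smooth_on_mult[OF smooth_on_const smX(1)]]] by metis
  obtain K2 where K2: "\<And>r. r \<in> J \<Longrightarrow> \<bar>m * (m - 1) * r powr (m - 2) * G1 r\<bar> \<le> K2"
    using bounded[OF smooth_on_continuous_on[OF smooth_on_mult[OF smooth_on_mult[OF smooth_on_const smX(1)] smG(2)]]]
    by metis
  obtain K3 where K3: "\<And>r. r \<in> J \<Longrightarrow> \<bar>b r\<bar> \<le> K3"
    using bounded[OF smooth_on_continuous_on[OF smb]] by metis
  have "\<kappa> * t * gradsq w (t, x) \<le> 1"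
  proof (rule gradient_estimate[where w = w and A = A and B = "\<lambda>z. b (v z)" and A' = A'
        and B' = "\<lambda>z. b' (v z) * G1 (v z)" and T = T and K = "max K1 (max K2 K3)"])
    show "smooth_on ({0<..<T} \<times> UNIV) A"
      unfolding A_def S_def[symmetric] using r zJ
      by (intro smooth_on_mult smooth_on_const smooth_on_powr v) auto
    show "smooth_on ({0<..<T} \<times> UNIV) (\<lambda>z. b (v z))"
      unfolding S_def[symmetric] by (rule smooth_on_compose[OF smb v vS])
    fix z assume "z \<in> {0<..<T} \<times> (UNIV :: (real^'n) set)"
    then have z: "z \<in> S" by (simp add: S_def)
    note rz = r[OF zJ[OF z]] and Gz = G0[OF zJ[OF z]] and GGz = GG1[OF zJ[OF z]]
    show "dt w z = A z * lap w z + b (v z) * gradsq w z"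
    proof -
      have "dt w z = m * v z powr (m - 1) * lap w z
          + (m * (m - 1) * v z powr (m - 2)
              - m * v z powr (m - 1) * (G (v z) * (L (v z) / v z)) / G (v z)) / G (v z) * gradsq w z"
        unfolding w_def
        using Gz by (intro transformed_pde[OF v S z vS J0 pde[OF z] W
              has_field_derivative_at_within[OF dG] smG(1)]) auto
      also have "(m * (m - 1) * v z powr (m - 2)
          - m * v z powr (m - 1) * (G (v z) * (L (v z) / v z)) / G (v z)) / G (v z)
          = m * v z powr (m - 2) * (((m - 1) - L (v z)) * (1 / G (v z)))"
        unfolding powers[OF zJ[OF z]] using Gz rz by (simp add: field_simps)
      also have "1 / G (v z) = G1 (v z)" using GGz Gz by (simp add: field_simps)
      also have "(m - 1) - L (v z) = E (v z)" by (simp add: L_def E_def field_simps)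
      finally show ?thesis by (simp add: A_def b_def)
    qed
    fix k
    show "dx k A z = A' z * dx k w z"
    proof -
      have "dx k A z = m * (v z powr (m - 1) * ((m - 1) / v z)) * dx k v z"
        unfolding A_def
        by (rule dd_compose_on[OF v S z vS
              has_field_derivative_at_within[OF DERIV_cmult[OF DERIV_powr_const[OF r(1)]]]])
      also have "\<dots> = m * (m - 1) * v z powr (m - 2) * dx k v z * (G (v z) * G1 (v z))"
        unfolding powers[OF zJ[OF z]] GGz using rz by simp
      finally show ?thesis by (simp add: A'_def dw[OF z])
    qed
    show "dx k (\<lambda>z. b (v z)) z = b' (v z) * G1 (v z) * dx k w z"
    proof -
      have "dx k (\<lambda>z. b (v z)) z = b' (v z) * dx k v z * (G (v z) * G1 (v z))"
        unfolding GGz using dd_compose_on[OF v S z vS has_field_derivative_at_within[OF db]] by simp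
      then show ?thesis by (simp add: dw[OF z])
    qed
    show "0 < A z" using m rz by (simp add: A_def)
    show "A z \<le> max K1 (max K2 K3)" using K1[OF zJ[OF z]] by (simp add: A_def)
    show "\<bar>A' z\<bar> \<le> max K1 (max K2 K3)" using K2[OF zJ[OF z]] by (simp add: A'_def)
    show "\<bar>b (v z)\<bar> \<le> max K1 (max K2 K3)" using K3[OF zJ[OF z]] by simp
    show "2 * (b' (v z) * G1 (v z)) + (real CARD('n) - 1) * (A' z)\<^sup>2 / (2 * A z) \<le> - \<kappa>"
      unfolding A_def A'_def by (rule main[OF zJ[OF z]])
  qed (use smw \<kappa>(2) t in \<open>auto simp: S_def\<close>)
  moreover have z: "(t, x) \<in> S" using t by (simp add: S_def)
  define s where "s = v (t, x)"
  have sJ: "s \<in> J" using zJ[OF z] by (simp add: s_def)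
  have "gradsq w (t, x) = (G s)\<^sup>2 * gradsq v (t, x)"
    unfolding w_def s_def by (rule gradsq_compose[OF v S z vS W])
  moreover have "(G s)\<^sup>2 = s powr (m + h - 3) / (N - X s)"
  proof -
    have "(s powr \<alpha>)\<^sup>2 = s powr (m + h - 3)"
      unfolding power2_eq_square powr_add[symmetric] by (simp add: \<alpha>_def)
    moreover have "((N - X s) powr (- 1 / 2))\<^sup>2 = (N - X s) powr (- 1)"
      unfolding power2_eq_square powr_add[symmetric] by simp
    ultimately show ?thesis using r[OF sJ] by (simp add: G_def power_mult_distrib pinv[OF sJ])
  qed
  ultimately have "\<kappa> * t * (s powr (m + h - 3) / (N - X s) * gradsq v (t, x)) \<le> 1" by simp
  then show ?thesis
    using r[OF sJ] by (simp add: s_def X_def field_simps)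
qed

section \<open>Powers of either sign, the essential supremum and the roots U\<close>

lemma powr_between_iff:
  fixes r a b h :: real
  assumes "h \<noteq> 0" "0 < a" "0 < b" "0 < r"
  shows "r \<in> {min (a powr (1 / h)) (b powr (1 / h))..max (a powr (1 / h)) (b powr (1 / h))}
    \<longleftrightarrow> r powr h \<in> {min a b..max a b}"
proof -
  have inv: "(a powr (1 / h)) powr h = a" if "0 < a" for a using assms(1) that by (simp add: powr_powr)
  have "(a powr (1 / h) \<le> r \<longleftrightarrow> (if h > 0 then a \<le> r powr h else r powr h \<le> a))
      \<and> (r \<le> a powr (1 / h) \<longleftrightarrow> (if h > 0 then r powr h \<le> a else a \<le> r powr h))" if "0 < a" for a
    using inv[OF that] assms(1,4) that
      powr_less_mono2[of h r "a powr (1 / h)"] powr_less_mono2[of h "a powr (1 / h)" r]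
      powr_less_mono2_neg[of h r "a powr (1 / h)"] powr_less_mono2_neg[of h "a powr (1 / h)" r]
    by (cases r "a powr (1 / h)" rule: linorder_cases; cases "h > 0"; force)
  then show ?thesis using assms by (auto simp: min_le_iff_disj le_max_iff_disj)
qed

text \<open>The inequality holds almost everywhere, and by continuity it describes a closed set; a
  closed set of full measure is the whole space.\<close>

lemma le_norm_inf:
  fixes f :: "real^'n \<Rightarrow> real"
  assumes "continuous_on UNIV f"
  shows "ereal \<bar>f y\<bar> \<le> norm_inf f"
proof -
  have "closed {y. ereal \<bar>f y\<bar> \<le> norm_inf f}"
  proof (cases "norm_inf f")
    case (real c)
    have "closed {y. \<bar>f y\<bar> \<le> c}"
      using assms by (intro closed_Collect_le continuous_intros) auto
    then show ?thesis using real by simp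
  qed auto
  moreover have "AE y in lebesgue. ereal \<bar>f y\<bar> \<le> norm_inf f"
    unfolding norm_inf_def by (intro AE_completion esssup_AE)
  ultimately have "y \<in> {y. ereal \<bar>f y\<bar> \<le> norm_inf f}"
    by (intro mem_closed_if_AE_lebesgue) auto
  then show ?thesis by simp
qed

text \<open>\<open>U_minus\<close> and \<open>U_plus\<close> are the roots of D U^2 - 2 m h U - h^2,
  since |h| sqrt (m^2 + D) is half the root of its discriminant.\<close>

lemma U_factorization:
  assumes "h_prod n m h > 0" "m > 0"
  shows "h_prod n m h * ((U - U_minus n m h) * (U_plus n m h - U)) = - h_prod n m h * U\<^sup>2 + 2 * m * h * U + h\<^sup>2"
proof -
  define D where "D = h_prod n m h"
  define s where "s = \<bar>h\<bar> * sqrt (m\<^sup>2 + D)"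
  have D: "D > 0" using assms by (simp add: D_def)
  have s: "s * s = h * h * (m * m + D)"
    using D by (simp add: s_def power2_eq_square algebra_simps flip: abs_mult)
  have "D * D * ((U - (m * h - s) / D) * ((m * h + s) / D - U)) = (D * U - (m * h - s)) * ((m * h + s) - D * U)"
    using D by (simp add: field_simps)
  also have "\<dots> = s * s - (D * U - m * h) * (D * U - m * h)" by (simp add: algebra_simps)
  also have "\<dots> = D * (- D * U\<^sup>2 + 2 * m * h * U + h\<^sup>2)"
    unfolding s by (simp add: algebra_simps power2_eq_square)
  finally show ?thesis
    using D by (simp add: U_minus_def U_plus_def D_def[symmetric] s_def[symmetric])
qed

theorem theorem5:
  fixes u :: "real \<Rightarrow> real^'n \<Rightarrow> real" and m h T :: real and x :: "real^'n"
  defines "D \<equiv> h_prod CARD('n) m h"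
    and "Um \<equiv> U_minus CARD('n) m h"
    and "Up \<equiv> U_plus CARD('n) m h"
    and "N \<equiv> norm_inf (\<lambda>y. u 0 y powr h)"
    and "U \<equiv> U_ratio u h T"
  assumes "m > 0"
    and smooth: "smooth_on ({0..} \<times> UNIV) (\<lambda>(t, y). u t y)"
    and pos: "\<And>t y. t \<ge> 0 \<Longrightarrow> u t y > 0"
    and bdd: "bounded ((\<lambda>(t, y). u t y) ` ({0..} \<times> UNIV))"
    and pde: "\<And>t y. t > 0 \<Longrightarrow>
      ((\<lambda>s. u s y) has_real_derivative laplacian (\<lambda>z. u t z powr m) y) (at t)"
    and "T > 0"
    and "D > 0"
    and "ereal Um < U" and "U < ereal Up"
  shows "u T x powr (m + h - 3) * (norm (gradient (u T) x))\<^sup>2 \<le>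
    (if U = 0 then 0
     else 2 * ((real_of_ereal N - u T x powr h) /
       (m * T * D * inverse (real_of_ereal U) * (real_of_ereal U - Um) * (Up - real_of_ereal U))))"
proof -
  define v where "v = (\<lambda>(t, y). u t y)"
  have v_eq: "v (t, y) = u t y" for t y by (simp add: v_def)
  let ?O = "{0<..} \<times> UNIV :: (real \<times> (real^'n)) set"
  have O: "open ?O" by (intro open_Times) auto
  have smv: "smooth_on ?O v"
    unfolding v_def by (rule smooth_on_subset[OF smooth]) auto
  have vpde: "dt v z = lap (\<lambda>z. v z powr m) z" if zO: "z \<in> ?O" for z
  proof -
    obtain t y where z: "z = (t, y)" "t > 0" using zO by auto
    have "((\<lambda>s. v ((0, y) + s *\<^sub>R (1, 0))) has_real_derivative dt v ((0, y) + t *\<^sub>R (1, 0))) (at t)"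
      using z by (intro dd_line[OF smv O]) auto
    then have "((\<lambda>s. u s y) has_real_derivative dt v z) (at t)" by (simp add: v_eq z)
    then have "dt v z = laplacian (\<lambda>y. u t y powr m) y"
      using pde[OF z(2)] DERIV_unique by blast
    also have "\<dots> = lap (\<lambda>z. v z powr m) (t, y)"
      using laplacian_eq_lap[OF smooth_on_powr[OF smv, of m] O, of t y] z pos by (auto simp: v_def)
    finally show ?thesis by (simp add: z)
  qed
  interpret pm: porous_medium_solution v m
    by unfold_locales
      (use \<open>m > 0\<close> smv vpde pos smooth_on_continuous_on[OF smooth] in \<open>auto simp: v_def\<close>)
  have u0: "ereal (u 0 y powr h) \<le> N" for y
  proof -
    have "continuous_on UNIV (\<lambda>y. v (0, y) powr h)"
      by (rule continuous_on_compose2[OF pm.cont_powr[of 0]]) (auto intro!: continuous_intros)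
    from le_norm_inf[OF this, of y] show ?thesis by (simp add: v_eq N_def)
  qed
  have umin_le: "u_min u h T \<le> ereal (u t y powr h)" if "0 \<le> t" "t \<le> T" for t y
    unfolding u_min_def by (rule INF_lower2[of "(t, y)"]) (use that in auto)
  have umin_ge: "0 \<le> u_min u h T"
    unfolding u_min_def by (rule INF_greatest) auto
  have N0: "N > 0"
    using less_le_trans[OF _ u0[of x]] pos[of 0 x] by simp
  have U_eq: "U = N / u_min u h T - 1" by (simp add: U_def U_ratio_def N_def)
  obtain c where c: "u_min u h T = ereal c"
    using umin_le[of 0 x] umin_ge \<open>T > 0\<close> by (cases "u_min u h T") auto
  \<comment> \<open>A vanishing infimum would make U infinite, against the bound by
    \<open>Up\<close>.\<close>
  have c0: "c > 0"
  proof (rule ccontr)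
    assume "\<not> c > 0"
    then have "u_min u h T = 0" using umin_ge c by (simp add: zero_ereal_def)
    then have "U = \<infinity>" unfolding U_eq using N0 by (cases N) (auto simp: divide_ereal_def)
    then show False using \<open>U < ereal Up\<close> by simp
  qed
  obtain n where n: "N = ereal n"
  proof (cases N)
    case PInf
    then have "U = \<infinity>" unfolding U_eq c using c0 by simp
    then show ?thesis using \<open>U < ereal Up\<close> by simp
  qed (use N0 that in auto)
  have n0: "n > 0" using N0 n by simp
  define R where "R = n / c - 1"
  have U: "U = ereal R" unfolding U_eq n c R_def using c0 by (simp add: one_ereal_def)
  \<comment> \<open>For h = 0 both roots are 0, and no U lies strictly between them.\<close>
  have "h \<noteq> 0"
  proof
    assume "h = 0"
    then have "Um = 0" "Up = 0" by (auto simp: Um_def Up_def U_minus_def U_plus_def)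
    then show False using \<open>ereal Um < U\<close> \<open>U < ereal Up\<close> by simp
  qed
  have init: "u 0 y powr h \<le> n" for y using u0[of y] n by simp
  have ge_c: "c \<le> u t y powr h" if "0 \<le> t" "t \<le> T" for t y using umin_le[OF that, of y] c by simp
  have cn: "c \<le> n" using init[of x] ge_c[of 0 x] \<open>T > 0\<close> by simp
  \<comment> \<open>The interval of all r with c <= r^h <= n; for negative h the endpoints trade
    places.\<close>
  define \<delta> B where "\<delta> = min (c powr (1 / h)) (n powr (1 / h))"
    and "B = max (c powr (1 / h)) (n powr (1 / h))"
  have \<delta>0: "\<delta> > 0" using c0 n0 by (simp add: \<delta>_def)
  have range_iff: "r \<in> {\<delta>..B} \<longleftrightarrow> c \<le> r powr h \<and> r powr h \<le> n" if "r > 0" for r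
    using powr_between_iff[OF \<open>h \<noteq> 0\<close> c0 n0 that] cn by (simp add: \<delta>_def B_def)
  have range0: "v (0, y) \<in> {\<delta>..B}" for y
    using range_iff[of "v (0, y)"] pos[of 0 y] init[of y] ge_c[of 0 y] \<open>T > 0\<close> by (simp add: v_eq)
  \<comment> \<open>For h > 0 the infimum c bounds u from below and \<open>pm.upper_bound\<close>
    supplies the rest. For h < 0 it bounds u from above, and \<open>pm.lower_bound\<close> yields u
    >= \<delta>, hence u^h <= n.\<close>
  have range: "v (t, y) \<in> {\<delta>..B}" if t: "0 \<le> t" "t \<le> T" for t y
  proof (cases "h > 0")
    case True
    have h_mono: "r \<le> s" if "r powr h \<le> s powr h" "0 < s" for r s :: real
      using that powr_less_mono2[OF True, of s r] by fastforce
    have \<delta>h: "\<delta> powr h \<le> c"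
    proof -
      have "\<delta> powr h \<le> (c powr (1 / h)) powr h"
        using \<delta>0 True by (intro powr_mono2) (auto simp: \<delta>_def)
      then show ?thesis using c0 True by (simp add: powr_powr)
    qed
    have lower: "\<delta> \<le> v (s, z)" if "0 \<le> s" "s \<le> t" for s z
      using h_mono[of \<delta> "v (s, z)"] \<delta>h ge_c[of s z] pos[of s z] that t by (simp add: v_eq)
    obtain b where "\<And>z. z \<in> {0..} \<times> UNIV \<Longrightarrow> norm (v z) \<le> b"
      using bdd unfolding v_def[symmetric] bounded_iff by auto
    then have upper: "v (s, z) \<le> b" if "0 \<le> s" "s \<le> t" for s z
      using that by (fastforce dest: abs_le_D1)
    show ?thesis
      using pm.upper_bound[OF \<delta>0 lower upper] lower[of t y] range0 t by auto
  next
    case False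
    have "\<delta> \<le> v (t, y)"
      using pm.lower_bound[OF \<delta>0] range0 t by auto
    moreover have "(v (t, y)) powr h \<le> n"
    proof -
      have "v (t, y) powr h \<le> \<delta> powr h"
        using False \<open>\<delta> \<le> v (t, y)\<close> \<delta>0 by (intro powr_mono2') auto
      also have "\<delta> powr h \<le> n"
        using range_iff[OF \<delta>0] range0[of x] by auto
      finally show ?thesis .
    qed
    ultimately show ?thesis
      using range_iff[of "v (t, y)"] ge_c[OF t, of y] pos[OF t(1), of y] by (simp add: v_eq)
  qed
  have gradv: "(norm (gradient (u t) y))\<^sup>2 = gradsq v (t, y)" if "t > 0" for t y
  proof -
    have "partial_deriv i (u t) y = dx i v (t, y)" for i
      using partial_deriv_eq_dx[OF smv O, of t y i] that by (simp add: v_eq)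
    then show ?thesis
      by (simp add: gradsq_def gradient_def flip: sum_power2_vec) (simp add: power2_eq_square)
  qed
  show ?thesis
  proof (cases "R = 0")
    case True
    \<comment> \<open>The admissible interval collapses to a point, so u is constant in space at
      time T.\<close>
    then have "n = c" using c0 by (simp add: R_def)
    then have "u T y = \<delta>" for y
      using range[of T y] \<open>T > 0\<close> by (simp add: v_eq \<delta>_def B_def)
    then have "u T = (\<lambda>_. \<delta>)" by auto
    then have "gradient (u T) x = 0"
      by (simp add: gradient_def partial_deriv_def vec_eq_iff)
    then show ?thesis by (simp add: U True zero_ereal_def)
  next
    case False
    then have R: "R > 0" using cn c0 by (simp add: R_def field_simps less_le)
    \<comment> \<open>The decay rate at the largest possible \<rho>, attained for u^h = c, with n
      enlarged by \<eta>.\<close>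
    define \<kappa> where "\<kappa> \<eta> = m / 2 * (- D * ((n + \<eta>) / c - 1) + 2 * m * h + h\<^sup>2 / ((n + \<eta>) / c - 1))" for \<eta>
    define \<Phi> where "\<Phi> t = v (t, x) powr (m + h - 3) * gradsq v (t, x)" for t
    have est: "\<kappa> \<eta> * T * \<Phi> T \<le> n + \<eta> - v (T, x) powr h" if \<eta>: "\<eta> > 0" "\<kappa> \<eta> > 0" for \<eta>
    proof -
      have before: "\<kappa> \<eta> * t * \<Phi> t \<le> n + \<eta> - v (t, x) powr h" if t: "0 < t" "t < T" for t
        unfolding \<Phi>_def
      proof (rule weighted_gradient_estimate[where T = T and \<delta> = \<delta> and B = B])
        show "smooth_on ({0<..<T} \<times> UNIV) v" by (rule smooth_on_subset[OF smv]) auto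
        fix r assume r: "r \<in> {\<delta>..B}"
        then have r0: "r > 0" using \<delta>0 by auto
        have rr: "c \<le> r powr h" "r powr h \<le> n" using range_iff[OF r0] r by auto
        then show "r powr h < n + \<eta>" using \<eta> by simp
        define \<rho> \<rho>' where "\<rho> = (n + \<eta>) / r powr h - 1" and "\<rho>' = (n + \<eta>) / c - 1"
        have \<rho>: "0 < \<rho>" using rr \<eta> r0 by (simp add: \<rho>_def less_divide_eq)
        have \<rho>': "\<rho> \<le> \<rho>'" using rr \<eta> c0 n0 r0 by (auto simp: \<rho>_def \<rho>'_def intro!: divide_left_mono)
        \<comment> \<open>Both \<rho>-dependent terms decrease in \<rho>, the linear one because D >
          0.\<close>
        have "m / 2 * (- D * \<rho>' + 2 * m * h + h\<^sup>2 / \<rho>') \<le> m / 2 * (- D * \<rho> + 2 * m * h + h\<^sup>2 / \<rho>)"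
          using \<rho> \<rho>' \<open>D > 0\<close> \<open>m > 0\<close>
          by (intro mult_left_mono add_mono mult_left_mono_neg divide_left_mono) auto
        then show "\<kappa> \<eta> \<le> m / 2 * (- h_prod CARD('n) m h * ((n + \<eta>) / r powr h - 1) + 2 * m * h
            + h\<^sup>2 / ((n + \<eta>) / r powr h - 1))"
          unfolding \<kappa>_def \<rho>_def \<rho>'_def D_def .
      qed (use \<open>m > 0\<close> vpde range \<delta>0 \<eta> t in auto)
      \<comment> \<open>The range of u is controlled only up to T, so the estimate holds on the open
        interval first and reaches T by continuity; T / 2 stays clear of time 0.\<close>
      have cl: "closure {T / 2<..<T} = {T / 2..T}"
        using \<open>T > 0\<close> by (simp add: closure_greaterThanLessThan)
      have path: "continuous_on {T / 2..T} (\<lambda>t. f (t, x))" if "continuous_on ?O f" for f :: "real \<times> (real^'n) \<Rightarrow> real"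
        by (rule continuous_on_compose2[OF that]) (use \<open>T > 0\<close> in \<open>auto intro!: continuous_intros\<close>)
      have pw: "continuous_on {T / 2..T} (\<lambda>t. v (t, x) powr a)" for a
        by (rule path[OF smooth_on_continuous_on[OF smooth_on_powr[OF smv]]]) (use pos in \<open>auto simp: v_eq\<close>)
      have "continuous_on {T / 2..T} (\<lambda>t. \<kappa> \<eta> * t * \<Phi> t - (n + \<eta> - v (t, x) powr h))"
        unfolding \<Phi>_def
        by (intro continuous_on_diff continuous_on_mult continuous_on_const continuous_on_id pw
            path[OF smooth_on_continuous_on[OF smooth_on_gradsq[OF smv O]]])
      then have "\<kappa> \<eta> * T * \<Phi> T - (n + \<eta> - v (T, x) powr h) \<le> 0"
        using continuous_le_on_closure[of "{T / 2<..<T}" "\<lambda>t. \<kappa> \<eta> * t * \<Phi> t - (n + \<eta> - v (t, x) powr h)" T 0]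
          before \<open>T > 0\<close> unfolding cl by simp
      then show ?thesis by simp
    qed
    have UmUp: "Um < R" "R < Up" using \<open>ereal Um < U\<close> \<open>U < ereal Up\<close> by (auto simp: U)
    have \<kappa>0: "\<kappa> 0 = m * D * inverse R * (R - Um) * (Up - R) / 2"
    proof -
      have "\<kappa> 0 = m / 2 * (- D * R\<^sup>2 + 2 * m * h * R + h\<^sup>2) / R"
        using R by (simp add: \<kappa>_def R_def[symmetric] field_simps power2_eq_square)
      also have "- D * R\<^sup>2 + 2 * m * h * R + h\<^sup>2 = D * ((R - Um) * (Up - R))"
        using U_factorization[of "CARD('n)" m h R] \<open>D > 0\<close> \<open>m > 0\<close> by (simp add: D_def Um_def Up_def)
      finally show ?thesis by (simp add: field_simps)
    qed
    \<comment> \<open>Here U in (U_-, U_+) enters: it is the positivity of the limiting rate, which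
      passes to all small \<eta>.\<close>
    have \<kappa>0_pos: "\<kappa> 0 > 0"
      unfolding \<kappa>0 using UmUp R \<open>D > 0\<close> \<open>m > 0\<close> by simp
    have lim: "(\<kappa> \<longlongrightarrow> \<kappa> 0) (at_right 0)"
      unfolding \<kappa>_def using R c0 by (intro tendsto_intros) (auto simp: R_def)
    have "\<kappa> 0 * T * \<Phi> T \<le> n + 0 - v (T, x) powr h"
    proof (rule tendsto_le)
      show "((\<lambda>\<eta>. n + \<eta> - v (T, x) powr h) \<longlongrightarrow> n + 0 - v (T, x) powr h) (at_right 0)"
        by (intro tendsto_intros)
      show "((\<lambda>\<eta>. \<kappa> \<eta> * T * \<Phi> T) \<longlongrightarrow> \<kappa> 0 * T * \<Phi> T) (at_right 0)"
        by (intro tendsto_intros lim)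
      have "eventually (\<lambda>\<eta>. \<kappa> \<eta> > 0) (at_right 0)"
        using order_tendstoD(1)[OF lim \<kappa>0_pos] .
      moreover have "eventually (\<lambda>\<eta>::real. \<eta> > 0) (at_right 0)"
        by (rule eventually_at_right_less)
      ultimately show "eventually (\<lambda>\<eta>. \<kappa> \<eta> * T * \<Phi> T \<le> n + \<eta> - v (T, x) powr h) (at_right 0)"
        by eventually_elim (use est in auto)
    qed simp
    then have "\<Phi> T \<le> (n - u T x powr h) / (\<kappa> 0 * T)"
      using \<kappa>0_pos \<open>T > 0\<close> by (simp add: field_simps v_eq)
    also have "\<dots> = 2 * ((n - u T x powr h) / (m * T * D * inverse R * (R - Um) * (Up - R)))"
      unfolding \<kappa>0 using R UmUp \<open>D > 0\<close> \<open>m > 0\<close> \<open>T > 0\<close> by (simp add: field_simps)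
    finally show ?thesis
      using False gradv[OF \<open>T > 0\<close>, of x] by (simp add: U n \<Phi>_def v_eq zero_ereal_def)
  qed
qed

end
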